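(* Fix $0<\alpha\le\pi$, and let $\epsilon=\epsilon(n)$ satisfy $\epsilon\ge C_2\left(\frac{\log n}{n}\right)^{1/2}$ and $\epsilon\to0$ as $n\to\infty$. Then, asymptotically almost surely, $\mathrm{conn}\big(\mathcal{N}(\mathbb{S}^2_\alpha(n,\epsilon))\big)\ge 1$. If moreover $\alpha\ne\pi/2$, then asymptotically almost surely $$\mathrm{conn}\big(\mathcal{N}(\mathbb{S}^2_\alpha(n,\epsilon))\big)=1.$$
   Context: $\mathbb{S}^2$ is the unit sphere in $\mathbb{R}^{3}$ with geodesic distance $\mathbf{d}$ and uniform probability measure. For $\alpha,\epsilon\ge 0$ and $X\subset\mathbb{S}^2$, $\mathbb{S}^2_\alpha(X,\epsilon)$ is the graph with vertex set $X$ and $x\sim y$ iff $x\ne y$ and $\alpha-\epsilon\le \mathbf{d}(x,y)\le\alpha+\epsilon$. The random $\epsilon$-distance graph $\mathbb{S}^2_\alpha(n,\epsilon)$ is $\mathbb{S}^2_\alpha(X,\epsilon)$ with $X=\{X_1,\dots,X_n\}$, where the $X_i$ are i.i.d. uniform on $\mathbb{S}^2$. An event (depending on $n$) holds asymptotically almost surely (a.a.s.) if its probability tends to $1$ as $n\to\infty$. A set $X\subset\mathbb{S}^2$ is a $\delta$-net if every point of $\mathbb{S}^2$ is at geodesic distance at most $\delta$ from some point of $X$. $C_2$ denotes a fixed constant with the property that whenever $\epsilon(n)\ge C_2(\log n/n)^{1/2}$ and $\epsilon(n)\to0$, a.a.s. $n$ i.i.d. uniform points of $\mathbb{S}^2$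 form an $(\epsilon/4)$-net of $\mathbb{S}^2$ (such a constant exists). For a graph $G$, the neighborhood complex $\mathcal{N}(G)$ is the simplicial complex with vertex set $V(G)$ whose simplices are all $A\subset V(G)$ such that $\bigcap_{v\in A}N(v)\ne\emptyset$, where $N(v)$ is the set of neighbors of $v$. A nonempty space is $k$-connected ($k\ge0$) if for every $\ell=0,\dots,k$ every continuous map from $\mathbb{S}^\ell$ to it extends to the ball $\mathbb{B}^{\ell+1}$; $\mathrm{conn}(Y)$ is the largest $k$ such that $Y$ is $k$-connected (with $\mathrm{conn}(Y)=-1$ if $Y$ is nonempty but not $0$-connected). For a simplicial complex, these notions refer to its geometric realization. *)

theory Defs
  imports "HOL-Probability.Probability"
begin

(* The normalized surface measure of the sphere, obtained as the image of the uniform distribution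
   on the unit ball under x |-> x / norm x (which is sgn).  The centre, which sgn does not map to the
   sphere, has measure 0.  By prob_space_uniform_sphere and uniform_sphere_rotation_invariant this is
   a rotation-invariant probability measure on the sphere. *)
definition uniform_sphere :: "(real^3) measure" where
  "uniform_sphere =
     restrict_space (distr (uniform_measure lborel (cball 0 1)) borel sgn) (sphere 0 1)"

lemma sgn_in_sphere: "x \<noteq> 0 \<Longrightarrow> sgn x \<in> sphere 0 (1::real)" for x :: "real^3"
  by (simp add: norm_sgn)

lemma emeasure_uniform_sphere:
  assumes "A \<in> sets borel" "A \<subseteq> sphere 0 1"
  shows "emeasure uniform_sphere A =
    emeasure lborel (cball 0 1 \<inter> (sgn -` A)) / emeasure lborel (cball 0 1 :: (real^3) set)"
proof -
  have m: "sgn \<in> borel_measurable (borel :: (real^3) measure)"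
    unfolding sgn_div_norm[abs_def] by measurable
  have v: "sgn -` A \<in> sets (borel :: (real^3) measure)"
    using measurable_sets[OF m assms(1)] by simp
  have "emeasure uniform_sphere A = emeasure (distr (uniform_measure lborel (cball 0 1)) borel sgn) A"
    unfolding uniform_sphere_def using assms by (intro emeasure_restrict_space) auto
  also have "\<dots> = emeasure (uniform_measure lborel (cball 0 1)) (sgn -` A)"
    using assms m by (subst emeasure_distr) auto
  also have "\<dots> = emeasure lborel (cball 0 1 \<inter> (sgn -` A)) / emeasure lborel (cball 0 1 :: (real^3) set)"
    using v by (intro emeasure_uniform_measure) auto
  finally show ?thesis .
qed

lemma space_uniform_sphere: "space uniform_sphere = sphere 0 1"
  by (simp add: uniform_sphere_def space_restrict_space)

lemma sets_uniform_sphere: "sets uniform_sphere = sets (restrict_space borel (sphere 0 1))"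
  unfolding uniform_sphere_def by (intro sets_restrict_space_cong) simp

lemma emeasure_unit_cball3:
  "emeasure lborel (cball 0 1 :: (real^3) set) \<noteq> 0" "emeasure lborel (cball 0 1 :: (real^3) set) \<noteq> \<infinity>"
proof -
  have "emeasure lborel (cball 0 1 :: (real^3) set) = emeasure lebesgue (cball 0 1 :: (real^3) set)"
    by simp
  moreover have "measure lebesgue (cball 0 1 :: (real^3) set) > 0"
    using content_cball_pos[of 1 "0 :: real^3"] by simp
  ultimately show "emeasure lborel (cball 0 1 :: (real^3) set) \<noteq> 0"
    by (auto simp: measure_def)
  show "emeasure lborel (cball 0 1 :: (real^3) set) \<noteq> \<infinity>"
    using emeasure_lborel_cball_finite[of "0::real^3" 1] by simp
qed

lemma prob_space_uniform_sphere: "prob_space uniform_sphere"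
proof
  have "emeasure uniform_sphere (space uniform_sphere) =
      emeasure lborel (cball 0 1 \<inter> (sgn -` sphere 0 1) :: (real^3) set) / emeasure lborel (cball 0 1 :: (real^3) set)"
    unfolding space_uniform_sphere by (intro emeasure_uniform_sphere) auto
  also have "cball 0 1 \<inter> (sgn -` sphere 0 1) = cball 0 1 - {0 :: real^3}"
    by (auto simp: norm_sgn)
  also have "emeasure lborel (cball 0 1 - {0 :: real^3}) = emeasure lborel (cball 0 1 :: (real^3) set)"
    by (rule emeasure_Diff_null_set) (auto simp: null_sets_def)
  finally show "emeasure uniform_sphere (space uniform_sphere) = 1"
    using emeasure_unit_cball3 by (simp add: less_top)
qed

lemma uniform_sphere_rotation_invariant:
  fixes f :: "real^3 \<Rightarrow> real^3"
  assumes f: "orthogonal_transformation f"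
  shows "distr uniform_sphere uniform_sphere f = uniform_sphere"
proof (rule measure_eqI)
  have lin: "linear f" using f by (simp add: orthogonal_transformation_def)
  have nf: "norm (f x) = norm x" for x using f by (rule orthogonal_transformation_norm)
  have fb: "f \<in> borel_measurable borel"
    by (intro borel_measurable_continuous_onI linear_continuous_on linear_conv_bounded_linear[THEN iffD1] lin)
  have sg: "sgn \<in> borel_measurable (borel :: (real^3) measure)"
    unfolding sgn_div_norm[abs_def] by measurable
  have fm: "f \<in> measurable uniform_sphere uniform_sphere"
    using fb by (subst measurable_cong_sets[OF sets_uniform_sphere sets_uniform_sphere])
       (auto intro!: measurable_restrict_space3 simp: nf)
  fix A assume "A \<in> sets (distr uniform_sphere uniform_sphere f)"
  then have A: "A \<in> sets uniform_sphere" by simp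
  then have A': "A \<in> sets borel" "A \<subseteq> sphere 0 1"
    unfolding sets_uniform_sphere by (auto simp: sets_restrict_space_iff)
  let ?P = "f -` A \<inter> sphere 0 1"
  let ?B = "cball 0 1 \<inter> sgn -` A"
  have fA: "f -` A \<in> sets borel" using measurable_sets[OF fb A'(1)] by simp
  have sA: "sgn -` A \<in> sets (borel :: (real^3) measure)" using measurable_sets[OF sg A'(1)] by simp
  have P: "?P \<in> sets borel" using fA by auto
  have sP: "sgn -` ?P \<in> sets (borel :: (real^3) measure)" using measurable_sets[OF sg P] by simp
  have fsgn: "f (sgn x) = sgn (f x)" for x
    by (simp add: sgn_div_norm nf linear_scale[OF lin])
  have img: "f ` (cball 0 1 \<inter> sgn -` ?P) = ?B"
  proof (intro equalityI subsetI)
    fix y assume "y \<in> f ` (cball 0 1 \<inter> sgn -` ?P)"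
    then show "y \<in> ?B" by (auto simp: nf fsgn[symmetric])
  next
    fix y assume y: "y \<in> ?B"
    obtain x where x: "y = f x" using orthogonal_transformation_surj[OF f] by (metis surjD)
    have "sgn y \<in> sphere 0 1" using y A' by auto
    then have "norm (sgn x) = 1" using x by (simp add: fsgn[symmetric] nf)
    then show "y \<in> f ` (cball 0 1 \<inter> sgn -` ?P)" using y x by (auto simp: nf fsgn intro!: imageI)
  qed
  have bd: "bounded (cball 0 1 \<inter> sgn -` ?P)" by (meson bounded_cball bounded_subset inf_le1)
  have bm: "cball 0 1 \<inter> sgn -` ?P \<in> sets borel" "?B \<in> sets borel" using sP sA by auto
  have lm: "cball 0 1 \<inter> sgn -` ?P \<in> lmeasurable"
    using bd bm(1) by (intro bounded_set_imp_lmeasurable) auto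
  have lm2: "?B \<in> lmeasurable"
    using bm(2) by (intro bounded_set_imp_lmeasurable) (auto intro: bounded_subset[OF bounded_cball])
  have "measure lebesgue ?B = measure lebesgue (cball 0 1 \<inter> sgn -` ?P)"
    using measure_orthogonal_image[OF f lm] img by simp
  then have "emeasure lebesgue ?B = emeasure lebesgue (cball 0 1 \<inter> sgn -` ?P)"
    using lm lm2 by (simp add: emeasure_eq_measure2 fmeasurableD2)
  then have eq: "emeasure lborel ?B = emeasure lborel (cball 0 1 \<inter> sgn -` ?P)"
    using bm by simp
  have "emeasure (distr uniform_sphere uniform_sphere f) A = emeasure uniform_sphere ?P"
    using fm A by (simp add: emeasure_distr space_uniform_sphere)
  also have "\<dots> = emeasure uniform_sphere A"
    using emeasure_uniform_sphere[OF P] emeasure_uniform_sphere[OF A'] eq by simp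
  finally show "emeasure (distr uniform_sphere uniform_sphere f) A = emeasure uniform_sphere A" .
qed simp

definition iid_sphere :: "nat \<Rightarrow> (nat \<Rightarrow> real^3) measure" where
  "iid_sphere n = PiM {1..n} (\<lambda>_. uniform_sphere)"

definition aas :: "(nat \<Rightarrow> (nat \<Rightarrow> real^3) \<Rightarrow> bool) \<Rightarrow> bool" where
  "aas E \<longleftrightarrow> (\<lambda>n. \<P>(X in iid_sphere n. E n X)) \<longlonglongrightarrow> 1"

definition geodesic_dist :: "real^3 \<Rightarrow> real^3 \<Rightarrow> real" where
  "geodesic_dist x y = arccos (x \<bullet> y)"

definition is_net :: "real \<Rightarrow> (real^3) set \<Rightarrow> bool" where
  "is_net \<delta> X \<longleftrightarrow> X \<subseteq> sphere 0 1 \<and> (\<forall>y\<in>sphere 0 1. \<exists>x\<in>X. geodesic_dist x y \<le> \<delta>)"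

definition admissible_radius :: "real \<Rightarrow> (nat \<Rightarrow> real) \<Rightarrow> bool" where
  "admissible_radius C \<epsilon> \<longleftrightarrow>
     (\<forall>n\<ge>1. \<epsilon> n \<ge> C * sqrt (ln (real n) / real n)) \<and> \<epsilon> \<longlonglongrightarrow> 0"

definition net_constant :: "real \<Rightarrow> bool" where
  "net_constant C \<longleftrightarrow>
     (\<forall>\<epsilon>. admissible_radius C \<epsilon> \<longrightarrow> aas (\<lambda>n X. is_net (\<epsilon> n / 4) (X ` {1..n})))"

record 'a graph =
  verts :: "'a set"
  adj :: "'a \<Rightarrow> 'a \<Rightarrow> bool"

definition nbrs :: "'a graph \<Rightarrow> 'a \<Rightarrow> 'a set" where
  "nbrs G v = {w \<in> verts G. adj G v w}"

definition distance_graph :: "real \<Rightarrow> real \<Rightarrow> (real^3) set \<Rightarrow> (real^3) graph" where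
  "distance_graph \<alpha> \<epsilon> X =
     \<lparr>verts = X,
      adj = (\<lambda>x y. x \<noteq> y \<and> \<alpha> - \<epsilon> \<le> geodesic_dist x y \<and> geodesic_dist x y \<le> \<alpha> + \<epsilon>)\<rparr>"

(* The intersection is taken inside the vertex set, which matters only for the empty simplex. *)
definition neighborhood_complex :: "'a graph \<Rightarrow> 'a set set" where
  "neighborhood_complex G = {A. A \<subseteq> verts G \<and> verts G \<inter> (\<Inter>v\<in>A. nbrs G v) \<noteq> {}}"

(* Points are given by barycentric coordinates.  The product topology is the usual topology of the
   realization when the complex is finite, the only case needed; for infinite complexes it can be
   coarser than the weak topology. *)
definition geometric_realization :: "'a set set \<Rightarrow> ('a \<Rightarrow> real) topology" where
  "geometric_realization K =
     subtopology (powertop_real UNIV)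
       {b. (\<forall>v. 0 \<le> b v) \<and> {v. b v \<noteq> 0} \<in> K \<and> sum b {v. b v \<noteq> 0} = 1}"

definition nball :: "nat \<Rightarrow> (nat \<Rightarrow> real) topology" where
  "nball m = subtopology (Euclidean_space m) {x. (\<Sum>i<m. (x i)\<^sup>2) \<le> 1}"

(* nsphere l is the unit sphere of Euclidean_space (Suc l), hence the boundary of nball (Suc l). *)
definition k_connected :: "nat \<Rightarrow> 'a topology \<Rightarrow> bool" where
  "k_connected k Y \<longleftrightarrow>
     topspace Y \<noteq> {} \<and>
     (\<forall>l\<le>k. \<forall>f. continuous_map (nsphere l) Y f \<longrightarrow>
        (\<exists>g. continuous_map (nball (Suc l)) Y g \<and> (\<forall>x\<in>topspace (nsphere l). g x = f x)))"

(* The value is infinite if the space is k-connected for all k; the empty space gets -2. *)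
definition conn :: "'a topology \<Rightarrow> ereal" where
  "conn Y =
     (if topspace Y = {} then -2
      else Sup (insert (-1) {ereal (real k) | k. k_connected k Y}))"

end

theory Submission
  imports Defs
begin

text \<open>Let \<open>X\<close> be an \<open>\<epsilon>/4\<close>-net, with \<open>\<epsilon>\<close> small, and \<open>N\<close> the neighborhood complex. Every set of points of \<open>X\<close>
  within \<open>3\<epsilon>/4\<close> of a point \<open>p\<close> is a simplex, since some point of \<open>X\<close> is close to a point at distance \<open>\<alpha>\<close>
  from \<open>p\<close>. Bump functions of radius \<open>3\<epsilon>/8\<close> around the points of \<open>X\<close> therefore give a map \<open>g\<close> from the
  sphere to the realization of \<open>N\<close>.

  Every loop in the realization is homotopic to \<open>g \<circ> \<gamma>\<close> for a loop \<open>\<gamma>\<close> in the sphere, and hence trivial: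
  the loop is contiguous to an edge loop, and if \<open>v\<close>, \<open>v'\<close> have the common neighbor \<open>z\<close>, then \<open>\<gamma>\<close> can run
  from \<open>v\<close> to \<open>v'\<close> inside the annulus around \<open>z\<close>, where the images under \<open>g\<close> lie in the same simplex as
  \<open>v\<close> and \<open>v'\<close>.

  If \<open>\<alpha> \<noteq> \<pi>/2\<close>, the neighbors of a point lie in an open hemisphere, so the centroid of a point of the
  realization is nonzero. An extension of \<open>g\<close> to the ball would give, after taking centroids and
  normalizing, a map from the ball to the sphere that sends no boundary point to its antipode,
  contradicting Brouwer's fixed point theorem.\<close>

section \<open>Extending maps to geometric realizations\<close>

text \<open>The point set of \<open>geometric_realization\<close>. Its topology is that of the
  function type, so continuity can be stated with \<open>continuous_on\<close>.\<close>

definition realization_set :: "'a set set \<Rightarrow> ('a \<Rightarrow> real) set" where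
  "realization_set K = {b. (\<forall>v. 0 \<le> b v) \<and> {v. b v \<noteq> 0} \<in> K \<and> sum b {v. b v \<noteq> 0} = 1}"

lemma geometric_realization_top_of_set:
  "geometric_realization K = top_of_set (realization_set K)"
  by (simp add: geometric_realization_def realization_set_def euclidean_product_topology)

locale simplicial_complex =
  fixes K :: "'a set set"
  assumes finite_simplex: "A \<in> K \<Longrightarrow> finite A"
    and down_closed: "A \<in> K \<Longrightarrow> B \<subseteq> A \<Longrightarrow> B \<in> K"
begin

lemma realization_setI:
  assumes "\<And>v. 0 \<le> b v" "A \<in> K" "{v. b v \<noteq> 0} \<subseteq> A" "sum b A = 1"
  shows "b \<in> realization_set K"
proof -
  have "sum b {v. b v \<noteq> 0} = sum b A"
    using assms finite_simplex by (intro sum.mono_neutral_left) auto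
  then show ?thesis
    using assms down_closed[OF assms(2,3)] by (auto simp: realization_set_def)
qed

lemma realization_set_sum:
  assumes "b \<in> realization_set K" "finite A" "{v. b v \<noteq> 0} \<subseteq> A"
  shows "sum b A = 1"
proof -
  have "sum b {v. b v \<noteq> 0} = sum b A"
    using assms by (intro sum.mono_neutral_left) auto
  then show ?thesis using assms by (auto simp: realization_set_def)
qed

lemma realization_set_segment:
  assumes b: "b \<in> realization_set K" and c: "c \<in> realization_set K"
    and A: "{v. b v \<noteq> 0} \<union> {v. c v \<noteq> 0} \<in> K" and t: "0 \<le> t" "0 \<le> s" "t + s = 1"
  shows "(\<lambda>v. t * b v + s * c v) \<in> realization_set K"
proof (rule realization_setI[OF _ A])
  let ?A = "{v. b v \<noteq> 0} \<union> {v. c v \<noteq> 0}"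
  show "0 \<le> t * b v + s * c v" for v
    using b c t by (auto simp: realization_set_def)
  show "(\<Sum>v\<in>?A. t * b v + s * c v) = 1"
    using realization_set_sum[OF b finite_simplex[OF A]] realization_set_sum[OF c finite_simplex[OF A]] t
    by (simp add: sum.distrib flip: sum_distrib_left)
qed auto

text \<open>The straight-line homotopy from \<open>f\<close> to \<open>q\<close> is placed on the collar \<open>1/2 \<le> norm x \<le> 1\<close>.\<close>

lemma extends_if_contiguous:
  fixes f q :: "'m::euclidean_space \<Rightarrow> 'a \<Rightarrow> real"
  assumes f: "continuous_on (sphere 0 1) f" "\<And>x. x \<in> sphere 0 1 \<Longrightarrow> f x \<in> realization_set K"
    and q: "continuous_on (cball 0 1) q" "\<And>x. x \<in> cball 0 1 \<Longrightarrow> q x \<in> realization_set K"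
    and fq: "\<And>x. x \<in> sphere 0 1 \<Longrightarrow> {v. f x v \<noteq> 0} \<union> {v. q x v \<noteq> 0} \<in> K"
  obtains g where "continuous_on (cball 0 1) g" "\<And>x. x \<in> cball 0 1 \<Longrightarrow> g x \<in> realization_set K"
    "\<And>x. x \<in> sphere 0 1 \<Longrightarrow> g x = f x"
proof -
  define h where "h x = (\<lambda>v. (2 * norm x - 1) * f (sgn x) v + (2 - 2 * norm x) * q (sgn x) v)" for x
  define g where "g x = (if norm x \<le> 1/2 then q (2 *\<^sub>R x) else h x)" for x
  \<comment> \<open>Two closed pieces covering the ball, on which \<open>g\<close> is pasted.
    Removing the open ball keeps the discontinuity of \<open>sgn\<close> at 0 away from the
    collar.\<close>
  let ?B = "cball 0 (1/2) :: 'm set" and ?S = "cball 0 1 - ball 0 (1/2) :: 'm set"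
  have s: "sgn x \<in> sphere 0 1" if "x \<in> ?S" for x
    using that by (cases "x = 0") (auto simp: norm_sgn)
  have cs: "continuous_on ?S sgn"
    unfolding sgn_div_norm[abs_def] by (intro continuous_intros) auto
  have "continuous_on ?S (\<lambda>x. f (sgn x) v)" "continuous_on ?S (\<lambda>x. q (sgn x) v)" for v
    using continuous_on_compose2[OF continuous_on_product_then_coordinatewise[OF f(1), of v] cs]
      continuous_on_compose2[OF continuous_on_product_then_coordinatewise[OF q(1), of v] cs] s
    by (auto simp: image_subset_iff)
  then have ch: "continuous_on ?S h"
    unfolding h_def by (intro continuous_on_coordinatewise_then_product continuous_intros)
  have cq: "continuous_on ?B (\<lambda>x. q (2 *\<^sub>R x))"
    by (intro continuous_on_compose2[OF q(1)] continuous_intros) auto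
  have "continuous_on (?B \<union> ?S) g"
    unfolding g_def
  proof (rule continuous_on_cases[OF _ _ cq ch])
    show "closed ?S" by (intro closed_Diff) auto
    have "h x = q (2 *\<^sub>R x)" if "norm x = 1/2" for x
    proof -
      have "inverse (norm x) = 2" unfolding that by simp
      then have "sgn x = 2 *\<^sub>R x" unfolding sgn_div_norm by simp
      moreover have "2 * norm x - 1 = 0" "2 - 2 * norm x = 1" using that by auto
      ultimately show ?thesis by (simp only: h_def) simp
    qed
    then show "\<forall>x. x \<in> ?B \<and> \<not> norm x \<le> 1 / 2 \<or> x \<in> ?S \<and> norm x \<le> 1 / 2 \<longrightarrow> q (2 *\<^sub>R x) = h x"
      by force
  qed auto
  moreover have "?B \<union> ?S = cball 0 1" by auto
  ultimately have "continuous_on (cball 0 1) g" by simp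
  moreover have "g x \<in> realization_set K" if x: "x \<in> cball 0 1" for x
  proof (cases "norm x \<le> 1/2")
    case True
    then show ?thesis using q(2)[of "2 *\<^sub>R x"] by (simp add: g_def)
  next
    case False
    then have S: "sgn x \<in> sphere 0 1" using x s[of x] by simp
    have "h x \<in> realization_set K"
      unfolding h_def using S x False by (intro realization_set_segment f q fq) auto
    then show ?thesis using False by (simp add: g_def)
  qed
  moreover have "g x = f x" if "x \<in> sphere 0 1" for x
    using that by (simp add: g_def h_def sgn_div_norm)
  ultimately show thesis by (rule that)
qed

end

section \<open>Pasting paths, and extending sphere maps over balls\<close>

text \<open>At an integer the formula reads the start of the next path. At \<open>t = m\<close> it
  evaluates \<open>c m 0\<close>, which is why the last end point condition mentions a path with
  index \<open>m\<close>.\<close>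

lemma continuous_on_glue_unit_intervals:
  fixes c :: "nat \<Rightarrow> real \<Rightarrow> 'a::topological_space"
  assumes "\<And>i. i < m \<Longrightarrow> continuous_on {0..1} (c i)" "\<And>i. i < m \<Longrightarrow> c i 1 = c (Suc i) 0"
  shows "continuous_on {0..real m} (\<lambda>t. c (nat \<lfloor>t\<rfloor>) (frac t))"
  using assms
proof (induction m)
  case 0
  then show ?case by simp
next
  case (Suc m)
  let ?c = "\<lambda>t. c (nat \<lfloor>t\<rfloor>) (frac t)"
  have cm: "continuous_on {real m..real (Suc m)} (\<lambda>t. c m (t - real m))"
    by (intro continuous_on_compose2[OF Suc.prems(1)[of m]] continuous_intros) auto
  have "c m (t - real m) = ?c t" if "t \<in> {real m..real (Suc m)}" for t
  proof (cases "t = real (Suc m)")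
    case True
    have "\<lfloor>t\<rfloor> = int (Suc m)" using True by (metis floor_of_nat)
    then have "nat \<lfloor>t\<rfloor> = Suc m" "frac t = 0" "t - real m = 1" using True by (auto simp: frac_def)
    then show ?thesis by (simp only: Suc.prems(2)[OF lessI])
  next
    case False
    then have "\<lfloor>t\<rfloor> = int m" using that by (intro floor_unique) auto
    then show ?thesis by (simp add: frac_def)
  qed
  then have "continuous_on {real m..real (Suc m)} ?c" by (rule continuous_on_eq[OF cm])
  moreover have "continuous_on {0..real m} ?c" using Suc by simp
  ultimately have "continuous_on ({0..real m} \<union> {real m..real (Suc m)}) ?c"
    by (intro continuous_on_closed_Un) auto
  moreover have "{0..real m} \<union> {real m..real (Suc m)} = {0..real (Suc m)}" by auto
  ultimately show ?case by simp
qed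

text \<open>The jump of \<open>Arg2pi\<close> on the positive real axis is harmless since
  \<open>h\<close> closes up. Formally, the trivial homotopy of the loop \<open>h\<close> to itself
  induces a homotopy of circle maps, whose end maps are continuous.\<close>

lemma continuous_on_circle_Arg2pi:
  fixes h :: "real \<Rightarrow> 'a::topological_space"
  assumes "continuous_on {0..1} h" "h 0 = h 1"
  shows "continuous_on (sphere 0 1) (\<lambda>z. h (Arg2pi z / (2 * pi)))"
proof -
  have "homotopic_loops UNIV h h"
    using assms by (simp add: homotopic_loops_refl path_def pathfinish_def pathstart_def)
  from homotopic_loops_imp_homotopic_circlemaps[OF this]
  show ?thesis by (auto dest: homotopic_with_imp_continuous simp: o_def)
qed

text \<open>A map into a sphere of larger dimension is null-homotopic, and a null-homotopy amounts
  to an extension over the ball. Simple connectedness of the 2-sphere enters the proof here.\<close>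

lemma sphere_map_extends_to_cball:
  fixes f :: "'m::euclidean_space \<Rightarrow> 'a::euclidean_space"
  assumes "DIM('m) < DIM('a)" "continuous_on (sphere 0 1) f" "f \<in> sphere 0 1 \<rightarrow> sphere 0 1"
  obtains g where "continuous_on (cball 0 1) g" "g \<in> cball 0 1 \<rightarrow> sphere 0 1"
    "\<And>x. x \<in> sphere 0 1 \<Longrightarrow> g x = f x"
proof -
  obtain c where "homotopic_with_canon (\<lambda>z. True) (sphere 0 1) (sphere 0 1) f (\<lambda>x. c)"
    using inessential_spheremap_lowdim[OF assms] .
  then have "\<exists>g. continuous_on (cball 0 1) g \<and> g ` cball 0 1 \<subseteq> sphere 0 1 \<and> (\<forall>x\<in>sphere 0 1. g x = f x)"
    by (subst nullhomotopic_from_sphere_extension[symmetric]) blast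
  then show thesis using that by blast
qed

text \<open>Replaces the spheres and balls of \<open>k_connected\<close>, made of sequences, by
  those of any Euclidean space of dimension \<open>l + 1\<close>; \<open>real\<close>,
  \<open>complex\<close> and \<open>real^3\<close> will serve for
  \<open>l = 0, 1, 2\<close>.\<close>

lemma extension_property_nsphere_iff:
  fixes S :: "'b::topological_space set"
  assumes dim: "DIM('m::euclidean_space) = Suc l"
  shows "(\<forall>f. continuous_map (nsphere l) (top_of_set S) f \<longrightarrow>
      (\<exists>g. continuous_map (nball (Suc l)) (top_of_set S) g \<and> (\<forall>x\<in>topspace (nsphere l). g x = f x))) \<longleftrightarrow>
    (\<forall>f :: 'm \<Rightarrow> 'b. continuous_on (sphere 0 1) f \<and> f \<in> sphere 0 1 \<rightarrow> S \<longrightarrow>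
      (\<exists>g. continuous_on (cball 0 1) g \<and> g \<in> cball 0 1 \<rightarrow> S \<and> (\<forall>x\<in>sphere 0 1. g x = f x)))"
proof -
  define A where "A = {x :: nat \<Rightarrow> real. (\<Sum>i\<le>l. (x i)\<^sup>2) = 1 \<and> (\<forall>i>l. x i = 0)}"
  define B where "B = {x :: nat \<Rightarrow> real. (\<Sum>i\<le>l. (x i)\<^sup>2) \<le> 1 \<and> (\<forall>i>l. x i = 0)}"
  have A: "nsphere l = top_of_set A"
    by (simp add: nsphere A_def euclidean_product_topology)
  have "{x :: nat \<Rightarrow> real. \<forall>i\<ge>Suc l. x i = 0} \<inter> {x. (\<Sum>i<Suc l. (x i)\<^sup>2) \<le> 1} = B"
    unfolding B_def lessThan_Suc_atMost Suc_le_eq by blast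
  then have B: "nball (Suc l) = top_of_set B"
    by (simp add: nball_def Euclidean_space_def subtopology_subtopology euclidean_product_topology)
  obtain e where "bij_betw e {0..<DIM('m)} (Basis :: 'm set)"
    using ex_bij_betw_nat_finite[OF finite_Basis] by blast
  moreover have "{0..<DIM('m)} = {..l}" using dim by auto
  ultimately have e: "bij_betw e {..l} (Basis :: 'm set)" by simp
  \<comment> \<open>Coordinates with respect to the enumeration \<open>e\<close> of
    \<open>Basis\<close>. The map \<open>\<psi>\<close> pads with zeros beyond \<open>l\<close>,
    preserves the norm and is inverse to \<open>\<phi>\<close> on sequences that vanish beyond
    \<open>l\<close>.\<close>
  define \<phi> where "\<phi> x = (\<Sum>i\<le>l. x i *\<^sub>R e i)" for x :: "nat \<Rightarrow> real"
  define \<psi> where "\<psi> y = (\<lambda>i. if i \<le> l then y \<bullet> e i else 0)" for y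
  have \<phi>\<psi>: "\<phi> (\<psi> y) = y" for y
    using sum.reindex_bij_betw[OF e, of "\<lambda>b. (y \<bullet> b) *\<^sub>R b"]
    by (simp add: \<phi>_def \<psi>_def euclidean_representation)
  have \<psi>\<phi>: "\<psi> (\<phi> x) = x" if "\<forall>i>l. x i = 0" for x
  proof
    fix j
    have "\<phi> x \<bullet> e j = x j" if j: "j \<le> l"
    proof -
      have "e i \<bullet> e j = (if i = j then 1 else 0)" if "i \<le> l" for i
      proof -
        have "e i \<in> Basis" "e j \<in> Basis" "e i = e j \<longleftrightarrow> i = j"
          using e that j by (auto simp: bij_betw_def inj_on_def)
        then show ?thesis by (simp add: inner_Basis)
      qed
      then have "\<phi> x \<bullet> e j = (\<Sum>i\<le>l. if i = j then x i else 0)"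
        unfolding \<phi>_def inner_sum_left by (intro sum.cong) auto
      then show ?thesis using j by simp
    qed
    then show "\<psi> (\<phi> x) j = x j" using that by (simp add: \<psi>_def)
  qed
  have n\<psi>: "(\<Sum>i\<le>l. (\<psi> y i)\<^sup>2) = (norm y)\<^sup>2" for y
    using sum.reindex_bij_betw[OF e, of "\<lambda>b. (y \<bullet> b)\<^sup>2"]
    unfolding power2_norm_eq_inner euclidean_inner[of y y] by (simp add: \<psi>_def power2_eq_square)
  have c\<phi>: "continuous_on T \<phi>" for T
    unfolding \<phi>_def by (intro continuous_intros continuous_on_subset[OF continuous_on_product_coordinates]) auto
  have c\<psi>: "continuous_on T \<psi>" for T
  proof (rule continuous_on_coordinatewise_then_product)
    show "continuous_on T (\<lambda>y. \<psi> y i)" for i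
      by (cases "i \<le> l") (auto simp: \<psi>_def intro!: continuous_intros)
  qed
  have nn: "(norm y)\<^sup>2 = 1 \<longleftrightarrow> norm y = 1" "(norm y)\<^sup>2 \<le> 1 \<longleftrightarrow> norm y \<le> 1" for y :: 'm
    using power_mono_iff[of "norm y" 1 2] by (auto simp: abs_square_eq_1)
  have \<psi>A: "\<psi> y \<in> A" if "y \<in> sphere 0 1" for y
    using that n\<psi>[of y] by (simp add: A_def) (simp add: \<psi>_def)
  have \<psi>B: "\<psi> y \<in> B" if "y \<in> cball 0 1" for y
    using that n\<psi>[of y] by (simp add: B_def nn) (simp add: \<psi>_def)
  have \<phi>A: "\<phi> x \<in> sphere 0 1" if "x \<in> A" for x
    using that n\<psi>[of "\<phi> x"] \<psi>\<phi>[of x] by (simp add: A_def nn)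
  have \<phi>B: "\<phi> x \<in> cball 0 1" if "x \<in> B" for x
    using that n\<psi>[of "\<phi> x"] \<psi>\<phi>[of x] by (simp add: B_def nn)
  have AB: "\<psi> (\<phi> x) = x" if "x \<in> A \<or> x \<in> B" for x
    using that by (intro \<psi>\<phi>) (auto simp: A_def B_def)
  show ?thesis
    unfolding A B continuous_map_subtopology_eu topspace_euclidean_subtopology
  proof (intro iffI allI impI)
    fix f :: "'m \<Rightarrow> 'b"
    assume *: "\<forall>f. continuous_on A f \<and> f \<in> A \<rightarrow> S \<longrightarrow>
        (\<exists>g. (continuous_on B g \<and> g \<in> B \<rightarrow> S) \<and> (\<forall>x\<in>A. g x = f x))"
    assume f: "continuous_on (sphere 0 1) f \<and> f \<in> sphere 0 1 \<rightarrow> S"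
    have "continuous_on A (\<lambda>x. f (\<phi> x))" "(\<lambda>x. f (\<phi> x)) \<in> A \<rightarrow> S"
      using f \<phi>A by (auto intro!: continuous_on_compose2[OF _ c\<phi>, of "sphere 0 1"])
    with * obtain g where g: "continuous_on B g" "g \<in> B \<rightarrow> S" "\<forall>x\<in>A. g x = f (\<phi> x)"
      by blast
    then show "\<exists>g. continuous_on (cball 0 1) g \<and> g \<in> cball 0 1 \<rightarrow> S \<and> (\<forall>x\<in>sphere 0 1. g x = f x)"
      using \<psi>A \<psi>B \<phi>\<psi>
      by (intro exI[of _ "\<lambda>y. g (\<psi> y)"]) (auto intro!: continuous_on_compose2[OF _ c\<psi>, of B])
  next
    fix f :: "(nat \<Rightarrow> real) \<Rightarrow> 'b"
    assume *: "\<forall>f :: 'm \<Rightarrow> 'b. continuous_on (sphere 0 1) f \<and> f \<in> sphere 0 1 \<rightarrow> S \<longrightarrow>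
        (\<exists>g. continuous_on (cball 0 1) g \<and> g \<in> cball 0 1 \<rightarrow> S \<and> (\<forall>x\<in>sphere 0 1. g x = f x))"
    assume f: "continuous_on A f \<and> f \<in> A \<rightarrow> S"
    have "continuous_on (sphere 0 1) (\<lambda>x. f (\<psi> x))" "(\<lambda>x. f (\<psi> x)) \<in> sphere 0 1 \<rightarrow> S"
      using f \<psi>A by (auto intro!: continuous_on_compose2[OF _ c\<psi>, of A])
    with * obtain g where g: "continuous_on (cball 0 1) g" "g \<in> cball 0 1 \<rightarrow> S"
        "\<forall>x\<in>sphere 0 1. g x = f (\<psi> x)"
      by blast
    then show "\<exists>g. (continuous_on B g \<and> g \<in> B \<rightarrow> S) \<and> (\<forall>x\<in>A. g x = f x)"
      using \<phi>A \<phi>B AB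
      by (intro exI[of _ "\<lambda>y. g (\<phi> y)"]) (auto intro!: continuous_on_compose2[OF _ c\<phi>, of "cball 0 1"])
  qed
qed

section \<open>Geometry of the sphere\<close>

lemma abs_inner_sphere_le_1:
  fixes x y :: "real^3"
  assumes "x \<in> sphere 0 1" "y \<in> sphere 0 1"
  shows "\<bar>x \<bullet> y\<bar> \<le> 1"
  using Cauchy_Schwarz_ineq2[of x y] assms by simp

lemma geodesic_dist_commute: "geodesic_dist x y = geodesic_dist y x"
  by (simp add: geodesic_dist_def inner_commute)

lemma
  assumes "x \<in> sphere 0 1" "y \<in> sphere 0 1"
  shows geodesic_dist_nonneg: "0 \<le> geodesic_dist x y"
    and geodesic_dist_le_pi: "geodesic_dist x y \<le> pi"
    and cos_geodesic_dist: "cos (geodesic_dist x y) = x \<bullet> y"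
  using abs_inner_sphere_le_1[OF assms] by (auto simp: geodesic_dist_def abs_le_iff intro: arccos_lbound arccos_ubound)

lemma geodesic_dist_self: "x \<in> sphere 0 1 \<Longrightarrow> geodesic_dist x x = 0"
  by (simp add: geodesic_dist_def dot_square_norm)

text \<open>The components \<open>u\<close>, \<open>w\<close> of \<open>x\<close>, \<open>z\<close>
  orthogonal to \<open>y\<close> have norms \<open>sin ?a\<close> and \<open>sin ?b\<close>, so
  Cauchy-Schwarz bounds \<open>x \<bullet> z\<close> from below by \<open>cos (?a + ?b)\<close>.
  Cosine decreases only up to \<open>pi\<close>, but a sum beyond \<open>pi\<close> exceeds every
  distance.\<close>

lemma geodesic_dist_triangle:
  assumes x: "x \<in> sphere 0 1" and y: "y \<in> sphere 0 1" and z: "z \<in> sphere 0 1"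
  shows "geodesic_dist x z \<le> geodesic_dist x y + geodesic_dist y z"
proof (cases "geodesic_dist x y + geodesic_dist y z \<le> pi")
  case True
  let ?a = "geodesic_dist x y" and ?b = "geodesic_dist y z"
  define u where "u = x - (x \<bullet> y) *\<^sub>R y"
  define w where "w = z - (z \<bullet> y) *\<^sub>R y"
  have sq: "x \<bullet> x = 1" "y \<bullet> y = 1" "z \<bullet> z = 1"
    using x y z by (auto simp: dot_square_norm)
  have "u \<bullet> u = 1 - (cos ?a)\<^sup>2" "w \<bullet> w = 1 - (cos ?b)\<^sup>2" "u \<bullet> w = x \<bullet> z - cos ?a * cos ?b"
    using sq cos_geodesic_dist[OF x y] cos_geodesic_dist[OF y z]
    by (auto simp: u_def w_def inner_diff inner_commute power2_eq_square algebra_simps)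
  then have uw: "(norm u)\<^sup>2 = (sin ?a)\<^sup>2" "(norm w)\<^sup>2 = (sin ?b)\<^sup>2" "u \<bullet> w = x \<bullet> z - cos ?a * cos ?b"
    by (simp_all add: sin_squared_eq flip: dot_square_norm)
  have "0 \<le> sin ?a" "0 \<le> sin ?b"
    using geodesic_dist_nonneg geodesic_dist_le_pi x y z by (auto intro!: sin_ge_zero)
  then have "norm u = sin ?a" "norm w = sin ?b"
    using uw(1,2) by (simp_all add: power2_eq_iff_nonneg)
  then have "- (sin ?a * sin ?b) \<le> x \<bullet> z - cos ?a * cos ?b"
    using Cauchy_Schwarz_ineq2[of u w] uw(3) by simp
  then have "cos (?a + ?b) \<le> cos (geodesic_dist x z)"
    using cos_geodesic_dist[OF x z] by (simp add: cos_add)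
  then show ?thesis
    using True geodesic_dist_nonneg geodesic_dist_le_pi x y z
    by (subst (asm) cos_mono_le_eq) auto
next
  case False
  then show ?thesis using geodesic_dist_le_pi[OF x z] by linarith
qed

lemma continuous_on_geodesic_dist:
  assumes "continuous_on S f" "continuous_on S g"
    "\<And>x. x \<in> S \<Longrightarrow> f x \<in> sphere 0 1" "\<And>x. x \<in> S \<Longrightarrow> g x \<in> sphere 0 1"
  shows "continuous_on S (\<lambda>x. geodesic_dist (f x) (g x))"
  unfolding geodesic_dist_def
  using abs_inner_sphere_le_1[OF assms(3,4)] assms(1,2)
  by (intro continuous_on_arccos continuous_on_inner) (auto simp: abs_le_iff minus_le_iff)

section \<open>Polar coordinates and paths inside an annulus\<close>

text \<open>The axis is \<open>z\<close>, with \<open>t\<close> the polar angle and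
  \<open>\<phi>\<close> the longitude. Both run over all reals, so that paths can be drawn as
  segments in parameter space. The inner product of two points on one meridian gives their
  distance.\<close>

definition spherical_coordinates :: "real^3 \<Rightarrow> (real \<Rightarrow> real \<Rightarrow> real^3) \<Rightarrow> bool" where
  "spherical_coordinates z \<Psi> \<longleftrightarrow> continuous_on UNIV (\<lambda>(t, \<phi>). \<Psi> t \<phi>) \<and> (\<forall>t \<phi>. \<Psi> t \<phi> \<in> sphere 0 1) \<and>
    (\<forall>t t' \<phi>. \<Psi> t \<phi> \<bullet> \<Psi> t' \<phi> = cos (t - t')) \<and> (\<forall>t \<phi>. \<Psi> t \<phi> \<bullet> z = cos t) \<and>
    (\<forall>p\<in>sphere 0 1. \<exists>\<phi>. p = \<Psi> (geodesic_dist p z) \<phi>)"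

lemma ex_spherical_coordinates:
  fixes z :: "real^3"
  assumes z: "z \<in> sphere 0 1"
  shows "\<exists>\<Psi>. spherical_coordinates z \<Psi>"
proof -
  have "norm (axis 1 1 :: real^3) = 1" "norm z = 1"
    using z by (auto simp: norm_axis_1)
  then have "\<exists>T :: real^3 \<Rightarrow> real^3. orthogonal_transformation T \<and> T (axis 1 1) = z"
  proof (rule orthogonal_transformation_exists_1)
    fix f :: "real^3 \<Rightarrow> real^3"
    assume "orthogonal_transformation f" "f (axis 1 1) = z"
    then show ?thesis by (intro exI[of _ f]) simp
  qed
  then obtain T :: "real^3 \<Rightarrow> real^3" where T: "orthogonal_transformation T" "T (axis 1 1) = z" by blast
  have lin: "linear T" using T by (simp add: orthogonal_transformation_def)
  \<comment> \<open>The standard formula around the first axis, carried to the axis \<open>z\<close>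
    by an orthogonal map.\<close>
  define \<Psi> where "\<Psi> t \<phi> = T (vector [cos t, sin t * cos \<phi>, sin t * sin \<phi>])" for t \<phi>
  have ip: "T a \<bullet> T b = a \<bullet> b" for a b using T(1) by (simp add: orthogonal_transformation_def)
  have in1: "\<Psi> t \<phi> \<bullet> \<Psi> t' \<phi> = cos (t - t')" for t t' \<phi>
  proof -
    have "\<Psi> t \<phi> \<bullet> \<Psi> t' \<phi> =
        cos t * cos t' + sin t * cos \<phi> * (sin t' * cos \<phi>) + sin t * sin \<phi> * (sin t' * sin \<phi>)"
      unfolding \<Psi>_def ip by (simp add: inner_vec_def sum_3)
    also have "\<dots> = cos t * cos t' + sin t * sin t' * ((cos \<phi>)\<^sup>2 + (sin \<phi>)\<^sup>2)"
      by (simp only: power2_eq_square algebra_simps)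
    finally show ?thesis by (simp add: cos_diff)
  qed
  have in2: "\<Psi> t \<phi> \<bullet> z = cos t" for t \<phi>
    unfolding \<Psi>_def T(2)[symmetric] ip by (simp add: inner_vec_def sum_3 axis_def)
  have "\<Psi> t \<phi> \<in> sphere 0 1" for t \<phi>
    using in1[of t \<phi> t] by (simp add: norm_eq_sqrt_inner)
  moreover have "continuous_on UNIV (\<lambda>(t, \<phi>). \<Psi> t \<phi>)"
  proof -
    have *: "vector [a, b, c] = a *\<^sub>R axis 1 1 + b *\<^sub>R axis 2 1 + c *\<^sub>R (axis 3 1 :: real^3)" for a b c
      by (simp add: vec_eq_iff forall_3 axis_def)
    show ?thesis
      unfolding \<Psi>_def case_prod_unfold *
      by (intro continuous_on_compose2[OF linear_continuous_on[of T UNIV]] continuous_intros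
          linear_conv_bounded_linear[THEN iffD1] lin) auto
  qed
  moreover have "\<exists>\<phi>. p = \<Psi> (geodesic_dist p z) \<phi>" if p: "p \<in> sphere 0 1" for p
  proof -
    let ?t = "geodesic_dist p z"
    obtain q where q: "p = T q" using orthogonal_transformation_surj[OF T(1)] by (metis surjD)
    have "q $ 1 = p \<bullet> z"
      unfolding q T(2)[symmetric] ip by (simp add: inner_vec_def sum_3 axis_def)
    then have q1: "q $ 1 = cos ?t" by (simp add: cos_geodesic_dist[OF p z])
    have "norm q = 1" using p q T(1) by (simp add: orthogonal_transformation_norm)
    then have "(q $ 1)\<^sup>2 + (q $ 2)\<^sup>2 + (q $ 3)\<^sup>2 = 1"
      by (simp add: norm_eq_1 inner_vec_def sum_3 power2_eq_square)
    then have s: "(q $ 2)\<^sup>2 + (q $ 3)\<^sup>2 = (sin ?t)\<^sup>2"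
      unfolding q1 by (simp add: sin_squared_eq)
    \<comment> \<open>At a pole the sine vanishes and every longitude works; elsewhere division by
      the sine leaves a point of the unit circle.\<close>
    have "\<exists>\<phi>. q $ 2 = sin ?t * cos \<phi> \<and> q $ 3 = sin ?t * sin \<phi>"
    proof (cases "sin ?t = 0")
      case True
      then show ?thesis using s by (simp add: sum_power2_eq_zero_iff)
    next
      case False
      then have "(q $ 2 / sin ?t)\<^sup>2 + (q $ 3 / sin ?t)\<^sup>2 = 1"
        using s by (simp add: power_divide flip: add_divide_distrib)
      then obtain \<phi> where "q $ 2 / sin ?t = cos \<phi>" "q $ 3 / sin ?t = sin \<phi>"
        using sincos_total_2pi by metis
      then show ?thesis using False by (auto simp: field_simps intro!: exI[of _ \<phi>])
    qed
    then obtain \<phi> where "q $ 2 = sin ?t * cos \<phi>" "q $ 3 = sin ?t * sin \<phi>" by blast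
    then have "q = vector [cos ?t, sin ?t * cos \<phi>, sin ?t * sin \<phi>]"
      by (simp add: vec_eq_iff forall_3 q1)
    then have "p = \<Psi> ?t \<phi>" using q by (simp add: \<Psi>_def)
    then show ?thesis ..
  qed
  ultimately have "spherical_coordinates z \<Psi>"
    using in1 in2 by (simp add: spherical_coordinates_def)
  then show ?thesis by (rule exI[of _ \<Psi>])
qed

text \<open>The second coordinate is the barycentric weight of \<open>v'\<close> on the edge from \<open>v\<close> to \<open>v'\<close>. The first one
  may leave the annulus only near an end point, while the weight rests on the corresponding vertex.\<close>
lemma path_through_annulus:
  fixes z v v' :: "real^3"
  assumes z: "z \<in> sphere 0 1" and v: "v \<in> sphere 0 1" and v': "v' \<in> sphere 0 1"
    and lo: "0 \<le> lo" "lo \<le> pi" "lo \<le> hi" "0 \<le> \<delta>"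
    and vz: "lo - \<delta> \<le> geodesic_dist v z" "geodesic_dist v z \<le> hi + \<delta>"
    and vz': "lo - \<delta> \<le> geodesic_dist v' z" "geodesic_dist v' z \<le> hi + \<delta>"
  shows "path_component {(p, s). p \<in> sphere 0 1 \<and> 0 \<le> s \<and> s \<le> (1::real) \<and>
      ((s = 0 \<and> geodesic_dist p v \<le> \<delta>) \<or> (lo \<le> geodesic_dist p z \<and> geodesic_dist p z \<le> hi) \<or>
       (s = 1 \<and> geodesic_dist p v' \<le> \<delta>))} (v, 0) (v', 1)"
    (is "path_component ?W _ _")
proof -
  obtain \<Psi> where "spherical_coordinates z \<Psi>" using ex_spherical_coordinates[OF z] ..
  then have \<Psi>: "continuous_on UNIV (\<lambda>(t, \<phi>). \<Psi> t \<phi>)" "\<And>t \<phi>. \<Psi> t \<phi> \<in> sphere 0 1"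
    "\<And>t t' \<phi>. \<Psi> t \<phi> \<bullet> \<Psi> t' \<phi> = cos (t - t')" "\<And>t \<phi>. \<Psi> t \<phi> \<bullet> z = cos t"
    "\<And>p. p \<in> sphere 0 1 \<Longrightarrow> \<exists>\<phi>. p = \<Psi> (geodesic_dist p z) \<phi>"
    by (simp_all add: spherical_coordinates_def)
  have dz: "geodesic_dist (\<Psi> t \<phi>) z = t" if "0 \<le> t" "t \<le> pi" for t \<phi>
    using that by (simp add: geodesic_dist_def \<Psi>(4) arccos_cos)
  have d\<Psi>: "geodesic_dist (\<Psi> t \<phi>) (\<Psi> t' \<phi>) \<le> \<bar>t - t'\<bar>" if "\<bar>t - t'\<bar> \<le> pi" for t t' \<phi>
    using that by (simp add: geodesic_dist_def \<Psi>(3) arccos_cos_eq_abs)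
  \<comment> \<open>The nearest polar angle in the annulus. The cap at \<open>pi\<close> is there
    because \<open>hi\<close> may exceed \<open>pi\<close>, where the polar angle is no longer the
    distance to \<open>z\<close>.\<close>
  define c where "c t = max lo (min t (min hi pi))" for t
  have c: "lo \<le> c t" "c t \<le> hi" "0 \<le> c t" "c t \<le> pi" for t
    using lo by (auto simp: c_def)
  have seg: "path_component ?W (\<Psi> t \<phi>, s) (\<Psi> t' \<phi>', s')"
    if W: "\<And>\<tau>. 0 \<le> \<tau> \<Longrightarrow> \<tau> \<le> 1 \<Longrightarrow>
      (\<Psi> ((1 - \<tau>) * t + \<tau> * t') ((1 - \<tau>) * \<phi> + \<tau> * \<phi>'), (1 - \<tau>) * s + \<tau> * s') \<in> ?W" for t \<phi> s t' \<phi>' s'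
  proof -
    let ?h = "\<lambda>\<tau>. (\<Psi> ((1 - \<tau>) * t + \<tau> * t') ((1 - \<tau>) * \<phi> + \<tau> * \<phi>'), (1 - \<tau>) * s + \<tau> * s')"
    have "continuous_on {0..1} (\<lambda>\<tau>. (\<lambda>(t, \<phi>). \<Psi> t \<phi>) ((1 - \<tau>) * t + \<tau> * t', (1 - \<tau>) * \<phi> + \<tau> * \<phi>'))"
      by (intro continuous_on_compose2[OF \<Psi>(1)] continuous_intros) auto
    then have "path ?h" unfolding path_def by (intro continuous_intros) simp
    moreover have "path_image ?h \<subseteq> ?W" 
      unfolding path_image_def by (intro image_subsetI, rule W) auto
    ultimately show ?thesis
      unfolding path_component_def by (intro exI[of _ ?h]) (simp add: pathstart_def pathfinish_def)
  qed
  \<comment> \<open>Clamping changes the polar angle by at most \<open>\<delta>\<close>, and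
    distances along a meridian are at most differences of angles.\<close>
  have radial: "geodesic_dist (\<Psi> ((1 - \<tau>) * t + \<tau> * c t) \<phi>) (\<Psi> t \<phi>) \<le> \<delta>"
    if "0 \<le> \<tau>" "\<tau> \<le> 1" "lo - \<delta> \<le> t" "t \<le> hi + \<delta>" "0 \<le> t" "t \<le> pi" for \<tau> t \<phi>
  proof -
    have "(1 - \<tau>) * t + \<tau> * c t - t = \<tau> * (c t - t)" by (simp add: algebra_simps)
    then have "\<bar>(1 - \<tau>) * t + \<tau> * c t - t\<bar> = \<tau> * \<bar>c t - t\<bar>"
      using that(1) by (simp add: abs_mult)
    also have "\<dots> \<le> 1 * \<bar>c t - t\<bar>" using that by (intro mult_right_mono) auto
    finally have "\<bar>(1 - \<tau>) * t + \<tau> * c t - t\<bar> \<le> \<bar>c t - t\<bar>" by simp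
    moreover have "\<bar>c t - t\<bar> \<le> \<delta>" "\<bar>c t - t\<bar> \<le> pi"
      using that lo by (auto simp: c_def)
    ultimately show ?thesis using d\<Psi>[of "(1 - \<tau>) * t + \<tau> * c t" t \<phi>] by linarith
  qed
  let ?t = "geodesic_dist v z" and ?t' = "geodesic_dist v' z"
  obtain \<phi> \<phi>' where \<phi>: "v = \<Psi> ?t \<phi>" and \<phi>': "v' = \<Psi> ?t' \<phi>'" using \<Psi>(5) v v' by metis
  \<comment> \<open>Three segments: \<open>v\<close> slides along its meridian into the annulus with
    weight 0; the annulus is crossed while the weight runs from 0 to 1; the slide of
    \<open>v'\<close> is traversed backwards with weight 1.\<close>
  have 1: "path_component ?W (\<Psi> ?t \<phi>, 0) (\<Psi> (c ?t) \<phi>, 0)"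
  proof (rule seg)
    fix \<tau> :: real assume "0 \<le> \<tau>" "\<tau> \<le> 1"
    then have "geodesic_dist (\<Psi> ((1 - \<tau>) * ?t + \<tau> * c ?t) \<phi>) v \<le> \<delta>"
      using radial[of \<tau> ?t \<phi>] vz \<phi> geodesic_dist_nonneg[OF v z] geodesic_dist_le_pi[OF v z] by simp
    moreover have "(1 - \<tau>) * \<phi> + \<tau> * \<phi> = \<phi>" by (simp add: algebra_simps)
    ultimately show "(\<Psi> ((1 - \<tau>) * ?t + \<tau> * c ?t) ((1 - \<tau>) * \<phi> + \<tau> * \<phi>), (1 - \<tau>) * 0 + \<tau> * 0) \<in> ?W"
      using \<Psi>(2) by simp
  qed
  have 2: "path_component ?W (\<Psi> (c ?t) \<phi>, 0) (\<Psi> (c ?t') \<phi>', 1)"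
  proof (rule seg)
    fix \<tau> :: real assume \<tau>: "0 \<le> \<tau>" "\<tau> \<le> 1"
    let ?m = "(1 - \<tau>) * c ?t + \<tau> * c ?t'"
    have "lo \<le> ?m" "?m \<le> min hi pi"
      using convex_bound_le[of "- c ?t" "- lo" "- c ?t'" "1 - \<tau>" \<tau>]
        convex_bound_le[of "c ?t" "min hi pi" "c ?t'" "1 - \<tau>" \<tau>] c \<tau> by auto
    then show "(\<Psi> ?m ((1 - \<tau>) * \<phi> + \<tau> * \<phi>'), (1 - \<tau>) * 0 + \<tau> * 1) \<in> ?W"
      using \<Psi>(2) dz lo \<tau> by simp
  qed
  have 3: "path_component ?W (\<Psi> ?t' \<phi>', 1) (\<Psi> (c ?t') \<phi>', 1)"
  proof (rule seg)
    fix \<tau> :: real assume "0 \<le> \<tau>" "\<tau> \<le> 1"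
    then have "geodesic_dist (\<Psi> ((1 - \<tau>) * ?t' + \<tau> * c ?t') \<phi>') v' \<le> \<delta>"
      using radial[of \<tau> ?t' \<phi>'] vz' \<phi>' geodesic_dist_nonneg[OF v' z] geodesic_dist_le_pi[OF v' z] by simp
    moreover have "(1 - \<tau>) * \<phi>' + \<tau> * \<phi>' = \<phi>'" by (simp add: algebra_simps)
    ultimately show "(\<Psi> ((1 - \<tau>) * ?t' + \<tau> * c ?t') ((1 - \<tau>) * \<phi>' + \<tau> * \<phi>'), (1 - \<tau>) * 1 + \<tau> * 1) \<in> ?W"
      using \<Psi>(2) by simp
  qed
  show ?thesis
    using path_component_trans[OF path_component_trans[OF 1 2] path_component_sym[OF 3]]
    unfolding \<phi>[symmetric] \<phi>'[symmetric] .
qed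

section \<open>Measurability\<close>

lemma k_connected_homeomorphic_maps:
  assumes h: "homeomorphic_maps Y Y' h h'" and k: "k_connected k Y"
  shows "k_connected k Y'"
  unfolding k_connected_def
proof (intro conjI allI impI)
  have c: "continuous_map Y Y' h" "continuous_map Y' Y h'" "\<And>y. y \<in> topspace Y' \<Longrightarrow> h (h' y) = y"
    using h by (auto simp: homeomorphic_maps_def)
  show "topspace Y' \<noteq> {}"
    using continuous_map_image_subset_topspace[OF c(1)] k by (auto simp: k_connected_def)
  fix l f assume l: "l \<le> k" and f: "continuous_map (nsphere l) Y' f"
  from continuous_map_compose[OF f c(2)] k l obtain g where
    g: "continuous_map (nball (Suc l)) Y g" "\<forall>x\<in>topspace (nsphere l). g x = h' (f x)"
    unfolding k_connected_def by (metis comp_apply)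
  have "h (g x) = f x" if "x \<in> topspace (nsphere l)" for x
    using that g(2) c(3) continuous_map_image_subset_topspace[OF f] by (auto simp: image_subset_iff)
  then show "\<exists>g. continuous_map (nball (Suc l)) Y' g \<and> (\<forall>x\<in>topspace (nsphere l). g x = f x)"
    using continuous_map_compose[OF g(1) c(1)] by (intro exI[of _ "h \<circ> g"]) simp
qed

lemma conn_homeomorphic_space:
  assumes "Y homeomorphic_space Y'"
  shows "conn Y = conn Y'"
proof -
  obtain h h' where h: "homeomorphic_maps Y Y' h h'"
    using assms by (auto simp: homeomorphic_space_def)
  have "homeomorphic_maps Y' Y h' h"
    using h by (subst homeomorphic_maps_sym)
  from k_connected_homeomorphic_maps[OF this] k_connected_homeomorphic_maps[OF h]
  have "k_connected k Y = k_connected k Y'" for k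
    by blast
  moreover have "topspace Y = {} \<longleftrightarrow> topspace Y' = {}"
    by (simp only: homeomorphic_imp_surjective_map[OF homeomorphic_maps_imp_map[OF h], symmetric] image_is_empty)
  ultimately show ?thesis by (simp add: conn_def)
qed

lemma pushforward_realization_set:
  assumes h: "inj_on h V" and K: "K \<subseteq> Pow V" and b: "b \<in> realization_set K"
  shows "(\<lambda>w. if w \<in> h ` V then b (inv_into V h w) else 0) \<in> realization_set (image h ` K)"
    (is "?b \<in> _")
proof -
  have V: "{v. b v \<noteq> 0} \<subseteq> V" using b K by (auto simp: realization_set_def)
  have s: "{w. ?b w \<noteq> 0} = h ` {v. b v \<noteq> 0}"
  proof (intro equalityI subsetI)
    fix w assume w: "w \<in> {w. ?b w \<noteq> 0}"
    then obtain v where "v \<in> V" "w = h v" by (auto split: if_splits)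
    then show "w \<in> h ` {v. b v \<noteq> 0}" using w h by simp
  next
    fix w assume "w \<in> h ` {v. b v \<noteq> 0}"
    then obtain v where "b v \<noteq> 0" "w = h v" "v \<in> V" using V by auto
    then show "w \<in> {w. ?b w \<noteq> 0}" using h by simp
  qed
  have "sum ?b (h ` {v. b v \<noteq> 0}) = sum b {v. b v \<noteq> 0}"
  proof (subst sum.reindex)
    show "inj_on h {v. b v \<noteq> 0}" using h V by (rule inj_on_subset)
    show "sum (?b \<circ> h) {v. b v \<noteq> 0} = sum b {v. b v \<noteq> 0}"
      using V h by (intro sum.cong) (auto simp: subset_iff)
  qed
  then show ?thesis using b unfolding realization_set_def mem_Collect_eq s by auto
qed

lemma homeomorphic_space_geometric_realization_image:
  assumes h: "inj_on h V" and K: "K \<subseteq> Pow V"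
  shows "geometric_realization K homeomorphic_space geometric_realization (image h ` K)"
proof -
  define p where "p b = (\<lambda>w. if w \<in> h ` V then b (inv_into V h w) else 0)" for b :: "'a \<Rightarrow> real"
  define q where "q c = (\<lambda>v. if v \<in> V then c (h v) else 0)" for c :: "'b \<Rightarrow> real"
  have p: "p b \<in> realization_set (image h ` K)" if "b \<in> realization_set K" for b
    unfolding p_def by (rule pushforward_realization_set[OF h K that])
  have q: "q c \<in> realization_set K" if c: "c \<in> realization_set (image h ` K)" for c
  proof -
    \<comment> \<open>The reverse map \<open>q\<close> is itself a push-forward, along the inverse
      of \<open>h\<close>.\<close>
    have "inv_into V h ` h ` A = A" if "A \<in> K" for A
      using inv_into_image_cancel[OF h, of A] K that by blast
    then have "image (inv_into V h) ` image h ` K = K"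
      by (force simp: image_image)
    moreover have "inv_into V h ` h ` V = V" using h by (rule inv_into_image_cancel) simp
    moreover have "inv_into (h ` V) (inv_into V h) v = h v" if "v \<in> V" for v
      using h that by (intro inv_into_f_eq inj_on_inv_into) auto
    moreover have "image h ` K \<subseteq> Pow (h ` V)" using K by blast
    ultimately show ?thesis
      using pushforward_realization_set[OF _ _ c, of "inv_into V h" "h ` V"]
      by (auto simp: q_def inj_on_inv_into cong: if_cong)
  qed
  have "continuous_on (realization_set K) p"
  proof (rule continuous_on_coordinatewise_then_product)
    show "continuous_on (realization_set K) (\<lambda>b. p b w)" for w
      by (cases "w \<in> h ` V") (auto simp: p_def intro: continuous_on_subset[OF continuous_on_product_coordinates])
  qed
  moreover have "continuous_on (realization_set (image h ` K)) q"
  proof (rule continuous_on_coordinatewise_then_product)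
    show "continuous_on (realization_set (image h ` K)) (\<lambda>c. q c v)" for v
      by (cases "v \<in> V") (auto simp: q_def intro: continuous_on_subset[OF continuous_on_product_coordinates])
  qed
  moreover have "q (p b) = b" if "b \<in> realization_set K" for b
  proof -
    have "{v. b v \<noteq> 0} \<subseteq> V" using that K by (auto simp: realization_set_def)
    then show ?thesis using h by (auto simp: p_def q_def fun_eq_iff)
  qed
  moreover have "p (q c) = c" if "c \<in> realization_set (image h ` K)" for c
  proof -
    have "{v. c v \<noteq> 0} \<subseteq> h ` V" using that K unfolding realization_set_def by blast
    then show ?thesis using h by (auto simp: p_def q_def fun_eq_iff f_inv_into_f inv_into_into)
  qed
  ultimately have "homeomorphic_maps (geometric_realization K) (geometric_realization (image h ` K)) p q"
    using p q by (auto simp: homeomorphic_maps_def geometric_realization_top_of_set)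
  then show ?thesis by (auto simp: homeomorphic_space_def)
qed

section \<open>Relabelling of graphs, and events determined by the adjacency pattern\<close>

lemma mem_neighborhood_complex:
  "A \<in> neighborhood_complex G \<longleftrightarrow> A \<subseteq> verts G \<and> (\<exists>z\<in>verts G. \<forall>a\<in>A. adj G a z)"
  by (auto simp: neighborhood_complex_def nbrs_def)

lemma mem_neighborhood_complex_distance_graph:
  "A \<in> neighborhood_complex (distance_graph \<alpha> \<epsilon> X) \<longleftrightarrow>
    A \<subseteq> X \<and> (\<exists>z\<in>X. \<forall>a\<in>A. a \<noteq> z \<and> \<alpha> - \<epsilon> \<le> geodesic_dist a z \<and> geodesic_dist a z \<le> \<alpha> + \<epsilon>)"
  by (auto simp: mem_neighborhood_complex distance_graph_def)

lemma neighborhood_complex_graph_isomorphism: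
  assumes h: "inj_on h (verts G)" "verts G' = h ` verts G"
    and adj: "\<And>x y. x \<in> verts G \<Longrightarrow> y \<in> verts G \<Longrightarrow> adj G' (h x) (h y) = adj G x y"
  shows "neighborhood_complex G' = image h ` neighborhood_complex G"
proof -
  have *: "h ` A \<in> neighborhood_complex G' \<longleftrightarrow> A \<in> neighborhood_complex G" if "A \<subseteq> verts G" for A
  proof -
    have "(\<forall>a\<in>A. adj G' (h a) (h z)) = (\<forall>a\<in>A. adj G a z)" if "z \<in> verts G" for z
      using that \<open>A \<subseteq> verts G\<close> adj by (metis subsetD)
    then show ?thesis
      using that unfolding mem_neighborhood_complex h(2) by (simp add: image_mono)
  qed
  show ?thesis
  proof (intro equalityI subsetI)
    fix B assume B: "B \<in> neighborhood_complex G'"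
    then have "B \<subseteq> h ` verts G" by (simp add: neighborhood_complex_def h(2))
    then obtain A where "A \<subseteq> verts G" "B = h ` A" by (auto simp: subset_image_iff)
    then show "B \<in> image h ` neighborhood_complex G" using B * by auto
  next
    fix B assume "B \<in> image h ` neighborhood_complex G"
    then obtain A where "A \<in> neighborhood_complex G" "B = h ` A" by auto
    then show "B \<in> neighborhood_complex G'" using * by (auto simp: neighborhood_complex_def)
  qed
qed

text \<open>The probability of a non-measurable event is \<open>0\<close>, so measurability has to be proved. The homotopy
  type of the complex depends only on the following finite data.\<close>

definition adjacency_pattern :: "real \<Rightarrow> real \<Rightarrow> nat set \<Rightarrow> (nat \<Rightarrow> real^3) \<Rightarrow> (nat \<times> nat) set \<times> (nat \<times> nat) set" where
  "adjacency_pattern \<alpha> \<epsilon> I X =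
    ({(i, j) \<in> I \<times> I. X i = X j},
     {(i, j) \<in> I \<times> I. \<alpha> - \<epsilon> \<le> geodesic_dist (X i) (X j) \<and> geodesic_dist (X i) (X j) \<le> \<alpha> + \<epsilon>})"

text \<open>The equality part of the pattern makes sending \<open>X i\<close> to \<open>Y i\<close>
  a well-defined bijection even when sample points coincide; the distance part makes it a graph
  isomorphism.\<close>

lemma conn_neighborhood_complex_pattern_cong:
  assumes "adjacency_pattern \<alpha> \<epsilon> I X = adjacency_pattern \<alpha> \<epsilon> I Y"
  shows "conn (geometric_realization (neighborhood_complex (distance_graph \<alpha> \<epsilon> (X ` I)))) =
    conn (geometric_realization (neighborhood_complex (distance_graph \<alpha> \<epsilon> (Y ` I))))"
proof -
  have eq: "(X i = X j) = (Y i = Y j)"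
    and dist: "(\<alpha> - \<epsilon> \<le> geodesic_dist (X i) (X j) \<and> geodesic_dist (X i) (X j) \<le> \<alpha> + \<epsilon>) =
      (\<alpha> - \<epsilon> \<le> geodesic_dist (Y i) (Y j) \<and> geodesic_dist (Y i) (Y j) \<le> \<alpha> + \<epsilon>)"
    if "i \<in> I" "j \<in> I" for i j
    using assms that unfolding adjacency_pattern_def prod.inject set_eq_iff by auto
  define h where "h v = Y (inv_into I X v)" for v
  have h: "h (X i) = Y i" if "i \<in> I" for i
    using eq[of "inv_into I X (X i)" i] that by (simp add: h_def f_inv_into_f inv_into_into)
  have inj: "inj_on h (X ` I)" using eq h by (auto simp: inj_on_def)
  have im: "h ` X ` I = Y ` I" using h by (auto simp: image_iff)
  have "neighborhood_complex (distance_graph \<alpha> \<epsilon> (Y ` I)) =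
      image h ` neighborhood_complex (distance_graph \<alpha> \<epsilon> (X ` I))"
  proof (rule neighborhood_complex_graph_isomorphism)
    fix x y assume "x \<in> verts (distance_graph \<alpha> \<epsilon> (X ` I))" "y \<in> verts (distance_graph \<alpha> \<epsilon> (X ` I))"
    then obtain i j where ij: "i \<in> I" "j \<in> I" "x = X i" "y = X j" by (auto simp: distance_graph_def)
    then show "adj (distance_graph \<alpha> \<epsilon> (Y ` I)) (h x) (h y) = adj (distance_graph \<alpha> \<epsilon> (X ` I)) x y"
      by (simp add: distance_graph_def h eq[OF ij(1,2)] dist[OF ij(1,2)])
  qed (use inj im in \<open>simp_all add: distance_graph_def\<close>)
  moreover have "neighborhood_complex (distance_graph \<alpha> \<epsilon> (X ` I)) \<subseteq> Pow (X ` I)"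
    by (auto simp: neighborhood_complex_def distance_graph_def)
  ultimately show ?thesis
    using conn_homeomorphic_space[OF homeomorphic_space_geometric_realization_image[OF inj]] by simp
qed

lemma measurable_iid_sphere_component:
  assumes "i \<in> {1..n}"
  shows "(\<lambda>X. X i) \<in> borel_measurable (iid_sphere n)"
proof -
  have "(\<lambda>x. x) \<in> measurable uniform_sphere borel"
    by (subst measurable_cong_sets[OF sets_uniform_sphere refl]) (intro measurable_restrict_space1, simp)
  with measurable_component_singleton[OF assms] show ?thesis
    unfolding iid_sphere_def by (rule measurable_compose)
qed

lemma space_iid_sphere_component:
  assumes "X \<in> space (iid_sphere n)" "i \<in> {1..n}"
  shows "X i \<in> sphere 0 1"
  using PiE_mem[OF assms(1)[unfolded iid_sphere_def space_PiM] assms(2)] by (simp add: space_uniform_sphere)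

lemma measurable_geodesic_dist:
  assumes i: "i \<in> {1..n}" and j: "j \<in> {1..n}"
  shows "(\<lambda>X. geodesic_dist (X i) (X j)) \<in> borel_measurable (iid_sphere n)"
proof -
  \<comment> \<open>Truncating the argument to \<open>{-1..1}\<close> gives a function continuous on
    all reals; on the sample space the truncation changes nothing.\<close>
  have "(\<lambda>t. arccos (max (-1) (min 1 t))) \<in> borel_measurable borel"
    by (intro borel_measurable_continuous_onI continuous_on_arccos continuous_intros) auto
  then have "(\<lambda>X. arccos (max (-1) (min 1 (X i \<bullet> X j)))) \<in> borel_measurable (iid_sphere n)"
    using measurable_iid_sphere_component[OF i] measurable_iid_sphere_component[OF j]
    by (intro measurable_compose[OF borel_measurable_inner])
  moreover have "arccos (max (-1) (min 1 (X i \<bullet> X j))) = geodesic_dist (X i) (X j)"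
    if "X \<in> space (iid_sphere n)" for X
  proof -
    have "\<bar>X i \<bullet> X j\<bar> \<le> 1"
      using Cauchy_Schwarz_ineq2[of "X i" "X j"] space_iid_sphere_component[OF that] i j by auto
    then have "max (-1) (min 1 (X i \<bullet> X j)) = X i \<bullet> X j" by linarith
    then show ?thesis by (simp add: geodesic_dist_def)
  qed
  ultimately show ?thesis by (simp cong: measurable_cong)
qed

text \<open>There are finitely many patterns and \<open>P\<close> is constant where the pattern is.
  The event is therefore a finite union of cells, each cut out by finitely many measurable
  conditions.\<close>

lemma sets_iid_sphere_pattern:
  assumes cong: "\<And>X Y. adjacency_pattern \<alpha> \<epsilon> {1..n} X = adjacency_pattern \<alpha> \<epsilon> {1..n} Y \<Longrightarrow> P X = P Y"
  shows "{X \<in> space (iid_sphere n). P X} \<in> sets (iid_sphere n)"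
proof -
  let ?M = "iid_sphere n" and ?p = "adjacency_pattern \<alpha> \<epsilon> {1..n}"
  define F where "F = ?p ` {X \<in> space ?M. P X}"
  have F: "F \<subseteq> Pow ({1..n} \<times> {1..n}) \<times> Pow ({1..n} \<times> {1..n})"
    by (auto simp: F_def adjacency_pattern_def)
  have cell: "{X \<in> space ?M. ?p X = T} \<in> sets ?M" if "T \<in> F" for T
  proof -
    have "T \<in> Pow ({1..n} \<times> {1..n}) \<times> Pow ({1..n} \<times> {1..n})" using F that by blast
    then obtain T1 T2 where T: "T = (T1, T2)" "T1 \<subseteq> {1..n} \<times> {1..n}" "T2 \<subseteq> {1..n} \<times> {1..n}"
      by (elim SigmaE) (simp only: Pow_iff)
    have "?p X = T \<longleftrightarrow> (\<forall>i\<in>{1..n}. \<forall>j\<in>{1..n}. ((i, j) \<in> T1 \<longleftrightarrow> X i = X j) \<and>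
        ((i, j) \<in> T2 \<longleftrightarrow> \<alpha> - \<epsilon> \<le> geodesic_dist (X i) (X j) \<and> geodesic_dist (X i) (X j) \<le> \<alpha> + \<epsilon>))" for X
    proof -
      have sub: "A = {(i, j) \<in> I \<times> I. Q i j} \<longleftrightarrow> (\<forall>i\<in>I. \<forall>j\<in>I. (i, j) \<in> A \<longleftrightarrow> Q i j)"
        if "A \<subseteq> I \<times> I" for A I and Q :: "nat \<Rightarrow> nat \<Rightarrow> bool"
        using that by auto
      show ?thesis
        unfolding T(1) adjacency_pattern_def prod.inject eq_commute[of _ T1] eq_commute[of _ T2]
          sub[OF T(2)] sub[OF T(3)] by blast
    qed
    moreover have "Measurable.pred ?M (\<lambda>X. \<forall>i\<in>{1..n}. \<forall>j\<in>{1..n}. ((i, j) \<in> T1 \<longleftrightarrow> X i = X j) \<and>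
        ((i, j) \<in> T2 \<longleftrightarrow> \<alpha> - \<epsilon> \<le> geodesic_dist (X i) (X j) \<and> geodesic_dist (X i) (X j) \<le> \<alpha> + \<epsilon>))"
    proof (intro pred_intros_finite(3))
      fix i j assume i: "i \<in> {1..n}" "j \<in> {1..n}"
      note [measurable] = i[THEN measurable_iid_sphere_component] measurable_geodesic_dist[OF i]
      have "Measurable.pred ?M (\<lambda>X. dist (X i) (X j) = 0)" by measurable
      then have [measurable]: "Measurable.pred ?M (\<lambda>X. X i = X j)" by simp
      show "Measurable.pred ?M (\<lambda>X. ((i, j) \<in> T1 \<longleftrightarrow> X i = X j) \<and>
        ((i, j) \<in> T2 \<longleftrightarrow> \<alpha> - \<epsilon> \<le> geodesic_dist (X i) (X j) \<and> geodesic_dist (X i) (X j) \<le> \<alpha> + \<epsilon>))"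
        unfolding iff_conv_conj_imp by measurable
    qed auto
    ultimately show ?thesis by (simp add: pred_def)
  qed
  have "{X \<in> space ?M. P X} = (\<Union>T\<in>F. {X \<in> space ?M. ?p X = T})"
  proof (intro equalityI subsetI)
    fix X assume "X \<in> (\<Union>T\<in>F. {X \<in> space ?M. ?p X = T})"
    then obtain Y where "X \<in> space ?M" "P Y" "?p X = ?p Y" by (auto simp: F_def)
    then show "X \<in> {X \<in> space ?M. P X}" using cong[of X Y] by simp
  qed (auto simp: F_def)
  moreover have "finite F" using F by (rule finite_subset) auto
  ultimately show ?thesis using cell by (auto intro!: sets.finite_UN)
qed

section \<open>The neighborhood complex over a net\<close>

lemma unit_interval_Arg2pi:
  "Arg2pi z / (2 * pi) \<in> {0..<1}"
  using Arg2pi_ge_0[of z] Arg2pi_lt_2pi[of z] by simp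

locale sphere_net_graph =
  fixes X :: "(real^3) set" and \<alpha> \<epsilon> :: real
  assumes finite_X: "finite X" and net: "is_net (\<epsilon> / 4) X"
    and \<epsilon>_pos: "0 < \<epsilon>" and \<epsilon>_less: "\<epsilon> < \<alpha>" and \<alpha>_le_pi: "\<alpha> \<le> pi"
begin

abbreviation N where "N \<equiv> neighborhood_complex (distance_graph \<alpha> \<epsilon> X)"

lemma X_sphere: "x \<in> X \<Longrightarrow> x \<in> sphere 0 1"
  using net by (auto simp: is_net_def)

lemma ex_near: "p \<in> sphere 0 1 \<Longrightarrow> \<exists>x\<in>X. geodesic_dist x p \<le> \<epsilon> / 4"
  using net by (simp add: is_net_def)

text \<open>\<open>\<epsilon> < \<alpha>\<close> makes \<open>\<alpha> - \<epsilon>\<close>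
  positive, so the distance condition already excludes \<open>a = z\<close>.\<close>

lemma mem_N: "A \<in> N \<longleftrightarrow> A \<subseteq> X \<and>
  (\<exists>z\<in>X. \<forall>a\<in>A. \<alpha> - \<epsilon> \<le> geodesic_dist a z \<and> geodesic_dist a z \<le> \<alpha> + \<epsilon>)"
proof -
  have "a \<noteq> z" if "z \<in> X" "\<alpha> - \<epsilon> \<le> geodesic_dist a z" for a z
    using that geodesic_dist_self[OF X_sphere[OF that(1)]] \<epsilon>_less by auto
  then show ?thesis unfolding mem_neighborhood_complex_distance_graph by blast
qed

sublocale simplicial_complex N
proof
  show "finite A" if "A \<in> N" for A using that finite_X by (auto simp: mem_N intro: finite_subset)
  show "B \<in> N" if "A \<in> N" "B \<subseteq> A" for A B using that unfolding mem_N by blast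
qed

text \<open>Error budget: \<open>3 * \<epsilon> / 4\<close> from \<open>a\<close> to
  \<open>p\<close>, plus \<open>\<epsilon> / 4\<close> from the ideal common neighbor
  \<open>y\<close> to the net point \<open>z\<close>, adds up to \<open>\<epsilon>\<close>.\<close>

lemma ball_simplex:
  assumes p: "p \<in> sphere 0 1" and A: "A \<subseteq> X" "\<And>a. a \<in> A \<Longrightarrow> geodesic_dist a p \<le> 3 * \<epsilon> / 4"
  shows "A \<in> N"
proof -
  obtain \<Psi> where \<Psi>: "spherical_coordinates p \<Psi>" using ex_spherical_coordinates[OF p] ..
  \<comment> \<open>Any point at distance exactly \<open>\<alpha>\<close> from \<open>p\<close>; it
    exists as \<open>\<alpha> \<le> pi\<close>, and the longitude 0 is arbitrary.\<close>
  define y where "y = \<Psi> \<alpha> 0"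
  have y: "y \<in> sphere 0 1" "geodesic_dist y p = \<alpha>"
    using \<Psi> \<epsilon>_pos \<epsilon>_less \<alpha>_le_pi by (simp_all add: y_def spherical_coordinates_def geodesic_dist_def arccos_cos)
  obtain z where z: "z \<in> X" "geodesic_dist z y \<le> \<epsilon> / 4" using ex_near[OF y(1)] by blast
  have "\<alpha> - \<epsilon> \<le> geodesic_dist a z \<and> geodesic_dist a z \<le> \<alpha> + \<epsilon>" if a: "a \<in> A" for a
  proof -
    have s: "a \<in> sphere 0 1" "z \<in> sphere 0 1" using a A(1) z X_sphere by auto
    have "geodesic_dist a z \<le> geodesic_dist a p + geodesic_dist p z"
      "geodesic_dist p z \<le> geodesic_dist p y + geodesic_dist y z"
      "geodesic_dist y p \<le> geodesic_dist y z + geodesic_dist z p"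
      "geodesic_dist z p \<le> geodesic_dist z a + geodesic_dist a p"
      by (intro geodesic_dist_triangle s p y(1))+
    then show ?thesis
      using z(2) y(2) A(2)[OF a] geodesic_dist_commute[of y z] geodesic_dist_commute[of p y]
        geodesic_dist_commute[of z a] geodesic_dist_commute[of z p] by linarith
  qed
  then show ?thesis unfolding mem_N using z A(1) by blast
qed

section \<open>The map from the sphere to the realization\<close>

text \<open>The radius \<open>3 * \<epsilon> / 8\<close> exceeds the net radius
  \<open>\<epsilon> / 4\<close>, so some bump is positive at every \<open>p\<close>. Twice the
  radius is the bound in \<open>ball_simplex\<close>, so that a vertex within one radius of
  \<open>p\<close> can join the carrier.\<close>

definition bump :: "real^3 \<Rightarrow> real^3 \<Rightarrow> real" where
  "bump p x = max 0 (3 * \<epsilon> / 8 - geodesic_dist x p)"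

text \<open>The partition of unity made of the bumps, read as barycentric coordinates. It is the map
  called \<open>g\<close> in the introductory text.\<close>

definition sphere_map :: "real^3 \<Rightarrow> real^3 \<Rightarrow> real" where
  "sphere_map p = (\<lambda>x. if x \<in> X then bump p x / sum (bump p) X else 0)"

lemma bump_sum_pos:
  assumes "p \<in> sphere 0 1"
  shows "sum (bump p) X > 0"
proof -
  obtain x where "x \<in> X" "geodesic_dist x p \<le> \<epsilon> / 4" using ex_near[OF assms] by blast
  then show ?thesis using \<epsilon>_pos finite_X by (intro sum_pos2[of X x]) (auto simp: bump_def)
qed

lemma sphere_map_support:
  assumes "sphere_map p x \<noteq> 0"
  shows "x \<in> X" "geodesic_dist x p < 3 * \<epsilon> / 8"
  using assms by (auto simp: sphere_map_def bump_def split: if_splits)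

lemma sphere_map_realization:
  assumes p: "p \<in> sphere 0 1"
  shows "sphere_map p \<in> realization_set N"
proof (rule realization_setI)
  let ?A = "{x. sphere_map p x \<noteq> 0}"
  show "0 \<le> sphere_map p x" for x
    using bump_sum_pos[OF p] by (auto simp: sphere_map_def bump_def)
  show "?A \<in> N"
    using sphere_map_support[of p] \<epsilon>_pos by (intro ball_simplex[OF p]) (auto, fastforce)
  have "sum (sphere_map p) ?A = sum (sphere_map p) X"
    using finite_X sphere_map_support(1) by (intro sum.mono_neutral_left) auto
  also have "\<dots> = sum (bump p) X / sum (bump p) X"
    unfolding sum_divide_distrib by (intro sum.cong) (auto simp: sphere_map_def)
  finally show "sum (sphere_map p) ?A = 1" using bump_sum_pos[OF p] by simp
qed simp

lemma continuous_on_sphere_map: "continuous_on (sphere 0 1) sphere_map"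
proof (rule continuous_on_coordinatewise_then_product)
  fix x
  have c: "continuous_on (sphere 0 1) (\<lambda>p. bump p y)" if "y \<in> X" for y
    unfolding bump_def using X_sphere[OF that]
    by (intro continuous_intros continuous_on_geodesic_dist) auto
  show "continuous_on (sphere 0 1) (\<lambda>p. sphere_map p x)"
  proof (cases "x \<in> X")
    case True
    have "sum (bump p) X \<noteq> 0" if "p \<in> sphere 0 1" for p using bump_sum_pos[OF that] by simp
    then show ?thesis using True by (auto simp: sphere_map_def intro!: continuous_intros c)
  qed (simp add: sphere_map_def)
qed

text \<open>Two contiguity steps. In low dimension \<open>\<gamma>\<close> extends over the ball,
  hence so does \<open>sphere_map \<circ> \<gamma>\<close>. Then \<open>P\<close> extends, being
  contiguous to it, and finally \<open>f\<close>, because \<open>fP\<close> makes the carrier of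
  \<open>P x\<close> a face of that of \<open>f x\<close>.\<close>

lemma extends_if_contiguous_to_sphere_map:
  fixes f P :: "'m::euclidean_space \<Rightarrow> real^3 \<Rightarrow> real" and \<gamma> :: "'m \<Rightarrow> real^3"
  assumes dim: "DIM('m) < 3"
    and f: "continuous_on (sphere 0 1) f" "\<And>x. x \<in> sphere 0 1 \<Longrightarrow> f x \<in> realization_set N"
    and P: "continuous_on (sphere 0 1) P" "\<And>x. x \<in> sphere 0 1 \<Longrightarrow> P x \<in> realization_set N"
    and \<gamma>: "continuous_on (sphere 0 1) \<gamma>" "\<And>x. x \<in> sphere 0 1 \<Longrightarrow> \<gamma> x \<in> sphere 0 1"
    and fP: "\<And>x v. x \<in> sphere 0 1 \<Longrightarrow> P x v \<noteq> 0 \<Longrightarrow> f x v \<noteq> 0"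
    and P\<gamma>: "\<And>x. x \<in> sphere 0 1 \<Longrightarrow> {v. P x v \<noteq> 0} \<union> {v. sphere_map (\<gamma> x) v \<noteq> 0} \<in> N"
  obtains g where "continuous_on (cball 0 1) g" "\<And>x. x \<in> cball 0 1 \<Longrightarrow> g x \<in> realization_set N"
    "\<And>x. x \<in> sphere 0 1 \<Longrightarrow> g x = f x"
proof -
  obtain \<Gamma> where \<Gamma>: "continuous_on (cball 0 1) \<Gamma>" "\<Gamma> \<in> cball 0 1 \<rightarrow> sphere 0 1"
    "\<And>x. x \<in> sphere 0 1 \<Longrightarrow> \<Gamma> x = \<gamma> x"
    using sphere_map_extends_to_cball[of \<gamma>] \<gamma> dim by auto
  have "continuous_on (cball 0 1) (\<lambda>x. sphere_map (\<Gamma> x))"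
    using \<Gamma> by (intro continuous_on_compose2[OF continuous_on_sphere_map]) auto
  moreover have "sphere_map (\<Gamma> x) \<in> realization_set N" if "x \<in> cball 0 1" for x
    using \<Gamma>(2) that by (intro sphere_map_realization) auto
  moreover have "{v. P x v \<noteq> 0} \<union> {v. sphere_map (\<Gamma> x) v \<noteq> 0} \<in> N" if "x \<in> sphere 0 1" for x
    using P\<gamma>[OF that] \<Gamma>(3)[OF that] by simp
  ultimately obtain Q where Q: "continuous_on (cball 0 1) Q" "\<And>x. x \<in> cball 0 1 \<Longrightarrow> Q x \<in> realization_set N"
    "\<And>x. x \<in> sphere 0 1 \<Longrightarrow> Q x = P x"
    using extends_if_contiguous[OF P, of "\<lambda>x. sphere_map (\<Gamma> x)"] by blast
  have "{v. f x v \<noteq> 0} \<union> {v. Q x v \<noteq> 0} \<in> N" if "x \<in> sphere 0 1" for x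
  proof -
    have "{v. f x v \<noteq> 0} \<union> {v. Q x v \<noteq> 0} = {v. f x v \<noteq> 0}" using Q(3)[OF that] fP[OF that] by auto
    then show ?thesis using f(2)[OF that] by (simp add: realization_set_def)
  qed
  then show thesis using extends_if_contiguous[OF f Q(1,2)] that by blast
qed

lemma realization_set_support:
  assumes "b \<in> realization_set N" "b x \<noteq> 0"
  shows "x \<in> X"
  using assms unfolding realization_set_def mem_N by blast

section \<open>Maps of the 0-sphere\<close>

text \<open>The 0-sphere is finite, so an arbitrary choice of a vertex \<open>v x\<close> in the
  carrier of \<open>f x\<close> is continuous. It serves both as the vertex map \<open>P\<close> and
  as the map \<open>\<gamma>\<close> to the sphere.\<close>

lemma extends_from_0_sphere:
  fixes f :: "real \<Rightarrow> real^3 \<Rightarrow> real"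
  assumes f: "continuous_on (sphere 0 1) f" "\<And>x. x \<in> sphere 0 1 \<Longrightarrow> f x \<in> realization_set N"
  obtains g where "continuous_on (cball 0 1) g" "\<And>x. x \<in> cball 0 1 \<Longrightarrow> g x \<in> realization_set N"
    "\<And>x. x \<in> sphere 0 1 \<Longrightarrow> g x = f x"
proof -
  have fin: "finite (sphere 0 1 :: real set)"
  proof (rule finite_subset)
    show "sphere 0 1 \<subseteq> {-1, 1 :: real}" by auto
  qed simp
  define v where "v x = (SOME v. f x v \<noteq> 0)" for x
  have v: "f x (v x) \<noteq> 0" if "x \<in> sphere 0 1" for x
  proof -
    have "sum (f x) {v. f x v \<noteq> 0} = 1" using f(2)[OF that] by (simp add: realization_set_def)
    then have "{v. f x v \<noteq> 0} \<noteq> {}" by (metis sum.empty zero_neq_one)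
    then have "\<exists>v. f x v \<noteq> 0" by blast
    then show ?thesis unfolding v_def by (rule someI_ex)
  qed
  have vX: "v x \<in> X" if "x \<in> sphere 0 1" for x using realization_set_support[OF f(2) v] that by blast
  define P where "P x = (\<lambda>w. if w = v x then 1 else 0 :: real)" for x
  have supp: "{w. P x w \<noteq> 0} = {v x}" for x by (auto simp: P_def)
  have simplex: "{w. P x w \<noteq> 0} \<union> {w. sphere_map (v x) w \<noteq> 0} \<in> N" if "x \<in> sphere 0 1" for x
  proof (rule ball_simplex)
    show "v x \<in> sphere 0 1" using vX X_sphere that by blast
    show "{w. P x w \<noteq> 0} \<union> {w. sphere_map (v x) w \<noteq> 0} \<subseteq> X"
      unfolding supp using vX[OF that] sphere_map_support(1) by blast
    fix a assume "a \<in> {w. P x w \<noteq> 0} \<union> {w. sphere_map (v x) w \<noteq> 0}"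
    then show "geodesic_dist a (v x) \<le> 3 * \<epsilon> / 4"
      unfolding supp using geodesic_dist_self[OF X_sphere[OF vX[OF that]]] \<epsilon>_pos sphere_map_support(2)[of "v x" a]
      by auto
  qed
  have P: "P x \<in> realization_set N" if "x \<in> sphere 0 1" for x
    using down_closed[OF simplex[OF that], of "{v x}"] supp
    by (intro realization_setI[where A="{v x}"]) (auto simp: P_def)
  have vs: "v x \<in> sphere 0 1" if "x \<in> sphere 0 1" for x using vX X_sphere that by blast
  have fP: "f x w \<noteq> 0" if "x \<in> sphere 0 1" "P x w \<noteq> 0" for x w
    using that v[OF that(1)] by (auto simp: P_def split: if_splits)
  have dim: "DIM(real) < 3" by simp
  show thesis
  proof (rule extends_if_contiguous_to_sphere_map[of f P v])
    fix g assume "continuous_on (cball 0 1) g" "\<And>x. x \<in> cball 0 1 \<Longrightarrow> g x \<in> realization_set N"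
      "\<And>x. x \<in> sphere 0 1 \<Longrightarrow> g x = f x"
    then show thesis by (rule that)
  qed (fact dim f P vs fP simplex continuous_on_finite[OF fin])+
qed

section \<open>Edges and the subdivision of loops\<close>

text \<open>While \<open>s\<close> moves along an edge of the complex, a companion \<open>p\<close>
  moves in the sphere so that the point of the edge stays contiguous to
  \<open>sphere_map (p \<tau>)\<close>.\<close>

lemma edge_path:
  assumes vz: "z \<in> X" "v \<in> X" "v' \<in> X"
    and dv: "\<alpha> - \<epsilon> \<le> geodesic_dist v z" "geodesic_dist v z \<le> \<alpha> + \<epsilon>"
    and dv': "\<alpha> - \<epsilon> \<le> geodesic_dist v' z" "geodesic_dist v' z \<le> \<alpha> + \<epsilon>"
  obtains p :: "real \<Rightarrow> real^3" and s :: "real \<Rightarrow> real" where "continuous_on {0..1} p" "continuous_on {0..1} s"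
    "p 0 = v" "s 0 = 0" "p 1 = v'" "s 1 = (1::real)"
    "\<And>\<tau>. \<tau> \<in> {0..1} \<Longrightarrow> p \<tau> \<in> sphere 0 1 \<and> 0 \<le> s \<tau> \<and> s \<tau> \<le> 1 \<and>
      {x. (1 - s \<tau>) * of_bool (x = v) + s \<tau> * of_bool (x = v') \<noteq> 0} \<union> {x. sphere_map (p \<tau>) x \<noteq> 0} \<in> N"
proof -
  let ?\<delta> = "3 * \<epsilon> / 8"
  \<comment> \<open>The annulus around \<open>z\<close> is narrowed on both sides by the bump
    radius, so that the carrier of \<open>sphere_map p\<close> stays inside the full
    annulus.\<close>
  let ?W = "{(p, s). p \<in> sphere 0 1 \<and> 0 \<le> s \<and> s \<le> (1::real) \<and>
      ((s = 0 \<and> geodesic_dist p v \<le> ?\<delta>) \<or>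
       (\<alpha> - \<epsilon> + ?\<delta> \<le> geodesic_dist p z \<and> geodesic_dist p z \<le> \<alpha> + \<epsilon> - ?\<delta>) \<or>
       (s = 1 \<and> geodesic_dist p v' \<le> ?\<delta>))}"
  have sph: "z \<in> sphere 0 1" "v \<in> sphere 0 1" "v' \<in> sphere 0 1" using vz X_sphere by auto
  have "path_component ?W (v, 0) (v', 1)"
    using dv dv' \<epsilon>_pos \<epsilon>_less \<alpha>_le_pi by (intro path_through_annulus sph) auto
  then obtain c where c: "path c" "path_image c \<subseteq> ?W" "pathstart c = (v, 0)" "pathfinish c = (v', 1)"
    unfolding path_component_def by blast
  have simplex: "{x. (1 - s) * of_bool (x = v) + s * of_bool (x = v') \<noteq> 0} \<union> {x. sphere_map p x \<noteq> 0} \<in> N"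
    (is "?A \<in> N") if W: "(p, s) \<in> ?W" for p s
  proof -
    have p: "p \<in> sphere 0 1" using W by simp
    have AX: "?A \<subseteq> X" using vz sphere_map_support(1) by (auto split: if_splits)
    have near: "?A \<in> N" if u: "u \<in> sphere 0 1" "geodesic_dist p u \<le> ?\<delta>"
      and A: "?A \<subseteq> insert u {x. sphere_map p x \<noteq> 0}" for u
    proof (rule ball_simplex[OF u(1) AX])
      fix a assume a: "a \<in> ?A"
      show "geodesic_dist a u \<le> 3 * \<epsilon> / 4"
      proof (cases "a = u")
        case True
        then show ?thesis using geodesic_dist_self[OF u(1)] \<epsilon>_pos by simp
      next
        case False
        then have "geodesic_dist a p < ?\<delta>" using a A sphere_map_support(2) by blast
        moreover have "geodesic_dist a u \<le> geodesic_dist a p + geodesic_dist p u"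
          using a AX X_sphere u p by (intro geodesic_dist_triangle) auto
        ultimately show ?thesis using u(2) by linarith
      qed
    qed
    \<comment> \<open>While the weight rests on \<open>v\<close> or \<open>v'\<close>, the simplex
      comes from the ball around that vertex; in the narrowed annulus it comes from the common
      neighbor \<open>z\<close>.\<close>
    consider "s = 0" "geodesic_dist p v \<le> ?\<delta>" | "s = 1" "geodesic_dist p v' \<le> ?\<delta>"
      | "\<alpha> - \<epsilon> + ?\<delta> \<le> geodesic_dist p z" "geodesic_dist p z \<le> \<alpha> + \<epsilon> - ?\<delta>"
      using W by auto
    then show ?thesis
    proof cases
      case 1
      then show ?thesis by (intro near[OF sph(2)]) (auto split: if_splits)
    next
      case 2
      then show ?thesis by (intro near[OF sph(3)]) (auto split: if_splits)
    next
      case 3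
      have "\<alpha> - \<epsilon> \<le> geodesic_dist a z \<and> geodesic_dist a z \<le> \<alpha> + \<epsilon>" if a: "a \<in> ?A" for a
      proof (cases "a = v \<or> a = v'")
        case True
        then show ?thesis using dv dv' by auto
      next
        case False
        then have "geodesic_dist a p < ?\<delta>" using a sphere_map_support(2)[of p a] by auto
        moreover have "geodesic_dist a z \<le> geodesic_dist a p + geodesic_dist p z"
          "geodesic_dist p z \<le> geodesic_dist p a + geodesic_dist a z"
          using a AX X_sphere sph p by (intro geodesic_dist_triangle; auto)+
        ultimately show ?thesis using 3 geodesic_dist_commute[of a p] by linarith
      qed
      then show ?thesis unfolding mem_N using AX vz(1) by blast
    qed
  qed
  have cW: "c \<tau> \<in> ?W" if "\<tau> \<in> {0..1}" for \<tau>
    by (rule subsetD[OF c(2)]) (use that in \<open>simp add: path_image_def\<close>)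
  show thesis
  proof (rule that[of "\<lambda>\<tau>. fst (c \<tau>)" "\<lambda>\<tau>. snd (c \<tau>)"])
    show "continuous_on {0..1} (\<lambda>\<tau>. fst (c \<tau>))" "continuous_on {0..1} (\<lambda>\<tau>. snd (c \<tau>))"
      using c(1) by (auto simp: path_def intro: continuous_on_fst continuous_on_snd)
    fix \<tau> :: real assume \<tau>: "\<tau> \<in> {0..1}"
    obtain p s where ps: "c \<tau> = (p, s)" by (cases "c \<tau>")
    then have W: "(p, s) \<in> ?W" using cW[OF \<tau>] by (simp only:)
    then have "p \<in> sphere 0 1" "0 \<le> s" "s \<le> 1" by simp_all
    with simplex[OF W]
    show "fst (c \<tau>) \<in> sphere 0 1 \<and> 0 \<le> snd (c \<tau>) \<and> snd (c \<tau>) \<le> 1 \<and>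
      {x. (1 - snd (c \<tau>)) * of_bool (x = v) + snd (c \<tau>) * of_bool (x = v') \<noteq> 0} \<union>
      {x. sphere_map (fst (c \<tau>)) x \<noteq> 0} \<in> N"
      unfolding ps fst_conv snd_conv by blast
  qed (use c(3,4) in \<open>simp_all add: pathstart_def pathfinish_def\<close>)
qed

text \<open>Pigeonhole for weights with sum 1. The bound is the same for all \<open>b\<close>, as
  the uniform subdivision of a loop requires.\<close>

lemma realization_set_large_weight:
  assumes b: "b \<in> realization_set N"
  shows "\<exists>v\<in>X. b v \<ge> 1 / card X"
proof (rule ccontr)
  have "{v. b v \<noteq> 0} \<in> N" using b by (simp add: realization_set_def)
  then have sub: "{v. b v \<noteq> 0} \<subseteq> X" and ne: "X \<noteq> {}" by (auto simp: mem_N)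
  assume "\<not> ?thesis"
  then have "sum b X < (\<Sum>v\<in>X. 1 / card X)"
    using finite_X ne by (intro sum_strict_mono) auto
  also have "\<dots> = 1" using finite_X ne by simp
  finally show False using realization_set_sum[OF b finite_X sub] by simp
qed

text \<open>Simplicial approximation of a loop: \<open>v i\<close> has weight at least
  \<open>1 / card X\<close> at the division point \<open>i / M\<close>, and the mesh is so fine that
  this weight cannot drop to 0 on the two adjacent pieces.\<close>

lemma edge_subdivision:
  fixes F :: "real \<Rightarrow> real^3 \<Rightarrow> real"
  assumes F: "continuous_on {0..1} F" "\<And>t. t \<in> {0..1} \<Longrightarrow> F t \<in> realization_set N" and loop: "F 0 = F 1"
  obtains M :: nat and v where "M > 0" "v M = v 0"
    "\<And>i t. i < M \<Longrightarrow> t \<in> {0..1} \<Longrightarrow> F ((real i + t) / M) (v i) \<noteq> 0 \<and> F ((real i + t) / M) (v (Suc i)) \<noteq> 0"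
proof -
  have ne: "X \<noteq> {}"
  proof -
    have "{v. F 0 v \<noteq> 0} \<in> N" using F(2)[of 0] by (simp add: realization_set_def)
    then show ?thesis by (auto simp: mem_N)
  qed
  define r where "r = 1 / real (card X)"
  have r: "r > 0" using ne finite_X by (simp add: r_def card_gt_0_iff)
  have "\<exists>d>0. \<forall>t\<in>{0..1}. \<forall>t'\<in>{0..1}. dist t' t < d \<longrightarrow> dist (F t' v) (F t v) < r" for v
    using compact_uniformly_continuous[OF continuous_on_product_then_coordinatewise[OF F(1)] compact_Icc] r
    unfolding uniformly_continuous_on_def by blast
  then obtain d where d: "\<And>v. d v > 0"
    "\<And>v t t'. t \<in> {0..1} \<Longrightarrow> t' \<in> {0..1} \<Longrightarrow> dist t' t < d v \<Longrightarrow> dist (F t' v) (F t v) < r"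
    by metis
  \<comment> \<open>One modulus of continuity for all coordinates in the finite set
    \<open>X\<close>.\<close>
  define D where "D = Min (d ` X)"
  have D: "D > 0" "\<And>v. v \<in> X \<Longrightarrow> D \<le> d v"
    using d(1) finite_X ne by (auto simp: D_def)
  obtain M :: nat where M: "1 / D < real M" using reals_Archimedean2 by blast
  have "0 < 1 / D" using D(1) by simp
  then have M0: "M > 0" using M by linarith
  have MD: "1 / real M < D" using M M0 D(1) by (simp add: field_simps)
  \<comment> \<open>The chosen vertex depends on the point \<open>b\<close> alone and not on the
    index, so \<open>F 0 = F 1\<close> gives \<open>v M = v 0\<close>.\<close>
  define vtx where "vtx b = (SOME v. v \<in> X \<and> b v \<ge> r)" for b
  have vtx: "vtx b \<in> X \<and> b (vtx b) \<ge> r" if "b \<in> realization_set N" for b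
    using someI_ex[of "\<lambda>v. v \<in> X \<and> b v \<ge> r"] realization_set_large_weight[OF that] by (auto simp: vtx_def r_def)
  define v where "v i = vtx (F (real i / M))" for i
  have near: "F t (v i) \<noteq> 0" if i: "i \<le> M" and t: "t \<in> {0..1}" "\<bar>t - real i / M\<bar> \<le> 1 / M" for i t
  proof -
    have i1: "real i / M \<in> {0..1}" using i M0 by simp
    have vi: "v i \<in> X" "F (real i / M) (v i) \<ge> r" using vtx[OF F(2)[OF i1]] by (auto simp: v_def)
    have "dist t (real i / M) < d (v i)"
      using t(2) MD D(2)[OF vi(1)] by (simp add: dist_real_def)
    then have "dist (F t (v i)) (F (real i / M) (v i)) < r" using d(2)[OF i1 t(1)] by blast
    then show ?thesis using vi(2) by (auto simp: dist_real_def)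
  qed
  show thesis
  proof (rule that[OF M0])
    show "v M = v 0" using M0 loop by (simp add: v_def)
    fix i :: nat and t :: real assume i: "i < M" and t: "t \<in> {0..1}"
    have le: "real i + 1 \<le> real M" using i by linarith
    have "(real i + t) / M \<in> {0..1}" using t le M0 by (auto simp: divide_le_eq)
    moreover have "\<bar>(real i + t) / M - real i / M\<bar> \<le> 1 / M"
      using t M0 by (simp add: add_divide_distrib divide_right_mono)
    moreover have "(real i + t) / M - real (Suc i) / M = (t - 1) / M"
      by (simp add: diff_divide_distrib add_divide_distrib)
    then have "\<bar>(real i + t) / M - real (Suc i) / M\<bar> \<le> 1 / M"
      using t M0 by (simp add: divide_right_mono)
    ultimately show "F ((real i + t) / M) (v i) \<noteq> 0 \<and> F ((real i + t) / M) (v (Suc i)) \<noteq> 0"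
      using near[of i] near[of "Suc i"] i by simp
  qed
qed

section \<open>Centroids and the failure of 2-connectedness\<close>

definition centroid :: "(real^3 \<Rightarrow> real) \<Rightarrow> real^3" where
  "centroid b = (\<Sum>x\<in>X. b x *\<^sub>R x)"

lemma continuous_on_centroid: "continuous_on S centroid"
  unfolding centroid_def by (intro continuous_intros continuous_on_subset[OF continuous_on_product_coordinates]) auto

lemma inner_centroid_pos:
  assumes b: "b \<in> realization_set N" and u: "\<And>x. b x \<noteq> 0 \<Longrightarrow> x \<bullet> u > 0"
  shows "centroid b \<bullet> u > 0"
proof -
  obtain v where v: "v \<in> X" "b v \<ge> 1 / card X" using realization_set_large_weight[OF b] by blast
  have "card X > 0" using v(1) finite_X by (auto simp: card_gt_0_iff)
  then have "b v > 0" using v(2) by (smt (verit) divide_pos_pos of_nat_0_less_iff)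
  then have "b v * (v \<bullet> u) > 0" using u[of v] by simp
  moreover have "b x * (x \<bullet> u) \<ge> 0" for x
    using u[of x] b by (cases "b x = 0") (auto simp: realization_set_def)
  ultimately have "(\<Sum>x\<in>X. b x * (x \<bullet> u)) > 0" using v(1) finite_X by (intro sum_pos2[of X v]) auto
  then show ?thesis by (simp add: centroid_def inner_sum_left)
qed

text \<open>The bound on \<open>\<epsilon>\<close> keeps the neighbors of \<open>z\<close> off the
  great circle at distance \<open>pi / 2\<close>: they lie in the open hemisphere around
  \<open>z\<close> if \<open>\<alpha> < pi / 2\<close>, and around \<open>- z\<close>
  otherwise.\<close>

lemma centroid_nonzero:
  assumes \<epsilon>: "\<epsilon> < \<bar>\<alpha> - pi / 2\<bar>" and b: "b \<in> realization_set N"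
  shows "centroid b \<noteq> 0"
proof -
  have "{v. b v \<noteq> 0} \<in> N" using b by (simp add: realization_set_def)
  then obtain z where z: "z \<in> X"
    "\<And>x. b x \<noteq> 0 \<Longrightarrow> x \<in> X \<and> \<alpha> - \<epsilon> \<le> geodesic_dist x z \<and> geodesic_dist x z \<le> \<alpha> + \<epsilon>"
    unfolding mem_N by blast
  have sph: "x \<in> sphere 0 1" "z \<in> sphere 0 1" if "b x \<noteq> 0" for x using z X_sphere that by blast+
  show ?thesis
  proof (cases "\<alpha> < pi / 2")
    case True
    have "x \<bullet> z > 0" if x: "b x \<noteq> 0" for x
    proof -
      have "geodesic_dist x z < pi / 2" using z(2)[OF x] \<epsilon> True by linarith
      then have "cos (geodesic_dist x z) > 0"
        using geodesic_dist_nonneg[OF sph[OF x]] by (intro cos_gt_zero_pi) auto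
      then show ?thesis using cos_geodesic_dist[OF sph[OF x]] by simp
    qed
    then show ?thesis using inner_centroid_pos[OF b, of z] by auto
  next
    case False
    have "x \<bullet> (- z) > 0" if x: "b x \<noteq> 0" for x
    proof -
      have "pi / 2 < geodesic_dist x z" using z(2)[OF x] \<epsilon> False by linarith
      then have "cos (pi - geodesic_dist x z) > 0"
        using geodesic_dist_le_pi[OF sph[OF x]] by (intro cos_gt_zero_pi) auto
      then show ?thesis using cos_geodesic_dist[OF sph[OF x]] by simp
    qed
    then show ?thesis using inner_centroid_pos[OF b, of "- z"] by auto
  qed
qed

lemma not_2_connected:
  assumes \<epsilon>: "\<epsilon> < \<bar>\<alpha> - pi / 2\<bar>"
  shows "\<not> k_connected 2 (geometric_realization N)"
proof
  assume "k_connected 2 (geometric_realization N)"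
  then have ext: "\<forall>f. continuous_map (nsphere 2) (top_of_set (realization_set N)) f \<longrightarrow>
      (\<exists>g. continuous_map (nball (Suc 2)) (top_of_set (realization_set N)) g \<and>
        (\<forall>x\<in>topspace (nsphere 2). g x = f x))"
    unfolding k_connected_def geometric_realization_top_of_set by blast
  have dim: "DIM(real^3) = Suc 2" by simp
  have "sphere_map \<in> sphere 0 1 \<rightarrow> realization_set N" using sphere_map_realization by blast
  with continuous_on_sphere_map
  have "\<exists>g. continuous_on (cball 0 1) g \<and> g \<in> cball 0 1 \<rightarrow> realization_set N \<and> (\<forall>x\<in>sphere 0 1. g x = sphere_map x)"
    by (intro extension_property_nsphere_iff[where 'm="real^3", OF dim, THEN iffD1, OF ext, THEN spec, THEN mp] conjI)
  then obtain g where g: "continuous_on (cball 0 1) g" "\<And>x. x \<in> cball 0 1 \<Longrightarrow> g x \<in> realization_set N"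
    "\<And>x. x \<in> sphere 0 1 \<Longrightarrow> g x = sphere_map x"
    by blast
  \<comment> \<open>With this sign, a boundary fixed point \<open>x\<close> would make the centroid
    of \<open>sphere_map x\<close> point along \<open>- x\<close>, although all carrier vertices are
    within \<open>3 * \<epsilon> / 8 < pi / 2\<close> of \<open>x\<close>.\<close>
  define h where "h x = - sgn (centroid (g x))" for x
  have nz: "centroid (g x) \<noteq> 0" if "x \<in> cball 0 1" for x
    using centroid_nonzero[OF \<epsilon> g(2)[OF that]] .
  have "continuous_on (cball 0 1) (\<lambda>x. centroid (g x))"
    by (rule continuous_on_compose2[OF continuous_on_centroid[of UNIV] g(1)]) simp
  then have "continuous_on (cball 0 1) h"
    unfolding h_def sgn_div_norm using nz by (intro continuous_intros) auto
  moreover have "norm (h x) = 1" if "x \<in> cball 0 1" for x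
    using nz[OF that] by (simp add: h_def norm_sgn)
  \<comment> \<open>All values of \<open>h\<close> have norm 1, so the fixed point lies on the
    boundary, where \<open>g\<close> is \<open>sphere_map\<close>.\<close>
  ultimately obtain x where x: "x \<in> cball 0 1" "h x = x" "norm x = 1"
    using brouwer_ball[of 1 0 h] by (metis Pi_I dist_0_norm mem_cball order_refl zero_less_one)
  then have sx: "x \<in> sphere 0 1" by simp
  have "centroid (sphere_map x) \<bullet> x > 0"
  proof (rule inner_centroid_pos[OF sphere_map_realization[OF sx]])
    fix y assume y: "sphere_map x y \<noteq> 0"
    then have yx: "y \<in> sphere 0 1" "geodesic_dist y x < 3 * \<epsilon> / 8"
      using sphere_map_support X_sphere by auto
    then have "geodesic_dist y x < pi / 2" using \<epsilon>_less \<alpha>_le_pi pi_gt_zero by linarith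
    then have "cos (geodesic_dist y x) > 0"
      using geodesic_dist_nonneg[OF yx(1) sx] by (intro cos_gt_zero_pi) auto
    then show "y \<bullet> x > 0" using cos_geodesic_dist[OF yx(1) sx] by simp
  qed
  then have "h x \<bullet> x \<le> 0"
    using g(3)[OF sx] by (simp add: h_def sgn_div_norm)
  moreover have "h x \<bullet> x = 1" using x by (simp add: norm_eq_1)
  ultimately show False by simp
qed

section \<open>Maps of the circle, and the value of \<open>conn\<close>\<close>

text \<open>The edge loop through the vertices \<open>v i\<close> and its companion in the sphere
  are built together, edge by edge; they are the \<open>P\<close> and \<open>\<gamma>\<close> of
  \<open>extends_if_contiguous_to_sphere_map\<close>.\<close>

lemma extends_from_1_sphere:
  fixes f :: "complex \<Rightarrow> real^3 \<Rightarrow> real"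
  assumes f: "continuous_on (sphere 0 1) f" "\<And>x. x \<in> sphere 0 1 \<Longrightarrow> f x \<in> realization_set N"
  obtains g where "continuous_on (cball 0 1) g" "\<And>x. x \<in> cball 0 1 \<Longrightarrow> g x \<in> realization_set N"
    "\<And>x. x \<in> sphere 0 1 \<Longrightarrow> g x = f x"
proof -
  define F where "F t = f (exp (\<i> * of_real (2 * pi * t)))" for t :: real
  have unit: "exp (\<i> * of_real (2 * pi * t)) \<in> sphere 0 1" for t :: real
    by simp
  have "continuous_on {0..1} F"
    unfolding F_def using unit by (intro continuous_on_compose2[OF f(1)] continuous_intros) blast
  moreover have FN: "F t \<in> realization_set N" for t
    unfolding F_def by (rule f(2)[OF unit])
  moreover have "F 0 = F 1"
  proof -
    have "exp (\<i> * of_real (2 * pi * 1)) = 1"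
      unfolding cis_conv_exp[symmetric] mult_1_right by (rule cis_2pi)
    then have "F 1 = f 1" by (simp only: F_def)
    then show ?thesis by (simp add: F_def)
  qed
  ultimately obtain M :: nat and v where M: "M > 0" and vM: "v M = v 0"
    and v: "\<And>i t. i < M \<Longrightarrow> t \<in> {0..1} \<Longrightarrow>
      F ((real i + t) / M) (v i) \<noteq> 0 \<and> F ((real i + t) / M) (v (Suc i)) \<noteq> 0"
    using edge_subdivision[of F] by metis
  define W where "W i p s \<longleftrightarrow> p \<in> sphere 0 1 \<and> 0 \<le> s \<and> s \<le> 1 \<and>
    {x. (1 - s) * of_bool (x = v i) + s * of_bool (x = v (Suc i)) \<noteq> 0} \<union> {x. sphere_map p x \<noteq> 0} \<in> N"
    for i p and s :: real
  have edge: "\<exists>(p :: real \<Rightarrow> real^3) (s :: real \<Rightarrow> real). continuous_on {0..1} p \<and> continuous_on {0..1} s \<and> p 0 = v i \<and> s 0 = 0 \<and>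
      p 1 = v (Suc i) \<and> s 1 = 1 \<and> (\<forall>\<tau>\<in>{0..1}. W i (p \<tau>) (s \<tau>))" if i: "i < M" for i
  proof -
    have "F (real i / M) (v i) \<noteq> 0 \<and> F (real i / M) (v (Suc i)) \<noteq> 0"
      using v[OF i, of 0] by simp
    moreover have "{x. F (real i / M) x \<noteq> 0} \<in> N" using FN by (simp add: realization_set_def)
    ultimately obtain z where "z \<in> X" "v i \<in> X" "v (Suc i) \<in> X"
      "\<alpha> - \<epsilon> \<le> geodesic_dist (v i) z" "geodesic_dist (v i) z \<le> \<alpha> + \<epsilon>"
      "\<alpha> - \<epsilon> \<le> geodesic_dist (v (Suc i)) z" "geodesic_dist (v (Suc i)) z \<le> \<alpha> + \<epsilon>"
      unfolding mem_N by blast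
    then obtain p :: "real \<Rightarrow> real^3" and s :: "real \<Rightarrow> real" where
      "continuous_on {0..1} p" "continuous_on {0..1} s" "p 0 = v i" "s 0 = 0" "p 1 = v (Suc i)" "s 1 = 1"
      "\<And>\<tau>. \<tau> \<in> {0..1} \<Longrightarrow> W i (p \<tau>) (s \<tau>)"
      unfolding W_def by (rule edge_path) blast
    then show ?thesis by (intro exI[of _ p] exI[of _ s]) simp
  qed
  \<comment> \<open>There is no edge with index \<open>M\<close>, but pasting reads the start of
    \<open>c M\<close>, so the initial value is prescribed for every \<open>i\<close>.\<close>
  have "\<exists>c :: real \<Rightarrow> (real^3) \<times> real. c 0 = (v i, 0) \<and> (i < M \<longrightarrow> continuous_on {0..1} c \<and> c 1 = (v (Suc i), 1) \<and>
      (\<forall>\<tau>\<in>{0..1}. W i (fst (c \<tau>)) (snd (c \<tau>))))" for i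
  proof (cases "i < M")
    case True
    from edge[OF True] obtain p :: "real \<Rightarrow> real^3" and s :: "real \<Rightarrow> real" where "continuous_on {0..1} p" "continuous_on {0..1} s"
      "p 0 = v i" "s 0 = 0" "p 1 = v (Suc i)" "s 1 = 1" "\<forall>\<tau>\<in>{0..1}. W i (p \<tau>) (s \<tau>)"
      by blast
    then show ?thesis by (intro exI[of _ "\<lambda>\<tau>. (p \<tau>, s \<tau>)"]) (auto intro: continuous_on_Pair)
  next
    case False
    then show ?thesis by (intro exI[of _ "\<lambda>_. (v i, 0)"]) auto
  qed
  then obtain c :: "nat \<Rightarrow> real \<Rightarrow> (real^3) \<times> real" where c0: "\<And>i. c i 0 = (v i, 0)"
    and c: "\<And>i. i < M \<Longrightarrow> continuous_on {0..1} (c i)" "\<And>i. i < M \<Longrightarrow> c i 1 = (v (Suc i), 1)"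
      "\<And>i \<tau>. i < M \<Longrightarrow> \<tau> \<in> {0..1} \<Longrightarrow> W i (fst (c i \<tau>)) (snd (c i \<tau>))"
    by metis
  \<comment> \<open>The form with \<open>of_bool\<close> has total weight 1 also on a degenerate
    edge \<open>v i = v (Suc i)\<close>.\<close>
  define w where "w i s = (\<lambda>x. (1 - s) * of_bool (x = v i) + s * of_bool (x = v (Suc i)))" for i and s :: real
  have w01: "w i 1 = w (Suc i) 0" for i by (simp add: w_def)
  \<comment> \<open>What is pasted is the point \<open>w i s\<close> and not the parameter
    \<open>s\<close>, which jumps from 1 back to 0 at each vertex.\<close>
  define C where "C i \<tau> = (fst (c i \<tau>), w i (snd (c i \<tau>)))" for i \<tau>
  define h where "h t = C (nat \<lfloor>real M * t\<rfloor>) (frac (real M * t))" for t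
  have glue: "continuous_on {0..real M} (\<lambda>t. C (nat \<lfloor>t\<rfloor>) (frac t))"
  proof (rule continuous_on_glue_unit_intervals)
    fix i assume i: "i < M"
    have "continuous_on {0..1} (\<lambda>\<tau>. w i (snd (c i \<tau>)))"
      unfolding w_def using c(1)[OF i]
      by (intro continuous_on_coordinatewise_then_product continuous_intros)
    then show "continuous_on {0..1} (C i)"
      unfolding C_def using c(1)[OF i] by (intro continuous_on_Pair continuous_on_fst)
    show "C i 1 = C (Suc i) 0" using w01 by (simp add: C_def c(2)[OF i] c0)
  qed
  have conth: "continuous_on {0..1} h"
    unfolding h_def
    by (rule continuous_on_compose2[OF glue, where f="\<lambda>t. real M * t"])
      (auto intro!: continuous_intros simp: mult_left_le)
  \<comment> \<open>At \<open>t = 1\<close> the formula reads the start of the fictitious edge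
    \<open>M\<close>, and \<open>v M = v 0\<close> closes the loop.\<close>
  have "\<lfloor>real M * 1\<rfloor> = int M" "frac (real M * 1) = 0" by (simp_all add: frac_def)
  then have "h 1 = C M 0" by (simp only: h_def nat_int)
  moreover have "h 0 = C 0 0" by (simp add: h_def)
  ultimately have h01: "h 0 = h 1" using vM by (simp add: C_def c0 w_def)
  let ?t = "\<lambda>z. Arg2pi z / (2 * pi)"
  have hz: "fst (h (?t z)) \<in> sphere 0 1 \<and> snd (h (?t z)) \<in> realization_set N \<and>
      (\<forall>x. snd (h (?t z)) x \<noteq> 0 \<longrightarrow> f z x \<noteq> 0) \<and>
      {x. snd (h (?t z)) x \<noteq> 0} \<union> {x. sphere_map (fst (h (?t z))) x \<noteq> 0} \<in> N"
    if z: "z \<in> sphere 0 1" for z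
  proof -
    define t where "t = ?t z"
    define i where "i = nat \<lfloor>real M * t\<rfloor>"
    define \<tau> where "\<tau> = frac (real M * t)"
    have t: "0 \<le> t" "t < 1" using unit_interval_Arg2pi[of z] by (auto simp: t_def)
    have fz: "f z = F t"
    proof -
      have "exp (\<i> * of_real (2 * pi * t)) = z" using z complex_norm_eq_1_exp[of z] by (simp add: t_def)
      then show ?thesis by (simp add: F_def)
    qed
    have i_eq: "real i = real_of_int \<lfloor>real M * t\<rfloor>" using t(1) by (simp add: i_def)
    have "real_of_int \<lfloor>real M * t\<rfloor> \<le> real M * t" by simp
    also have "\<dots> < real M" using t(2) M by simp
    finally have i: "i < M" using i_eq by simp
    have \<tau>: "\<tau> \<in> {0..1}" using frac_lt_1[of "real M * t"] by (simp add: \<tau>_def less_imp_le)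
    have "(real i + \<tau>) / M = t" using M by (simp add: i_eq \<tau>_def frac_def)
    \<comment> \<open>Both ends of the current edge lie in the carrier of \<open>f z\<close>; this
      makes the edge loop contiguous to \<open>f\<close>.\<close>
    then have v: "F t (v i) \<noteq> 0" "F t (v (Suc i)) \<noteq> 0" using v[OF i \<tau>] by auto
    obtain p s where ps: "c i \<tau> = (p, s)" by (cases "c i \<tau>")
    have W: "W i p s" using c(3)[OF i \<tau>] by (simp add: ps)
    have hps: "h t = (p, w i s)" by (simp add: h_def C_def ps flip: i_def \<tau>_def)
    have wx: "x = v i \<or> x = v (Suc i)" if "w i s x \<noteq> 0" for x
      using that by (auto simp: w_def split: if_splits)
    have wN: "w i s \<in> realization_set N"
    proof (rule realization_setI)
      show "{v i, v (Suc i)} \<in> N"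
        using v FN[of t] down_closed[of "{x. F t x \<noteq> 0}" "{v i, v (Suc i)}"] by (auto simp: realization_set_def)
      show "sum (w i s) {v i, v (Suc i)} = 1" by (cases "v i = v (Suc i)") (auto simp: w_def)
      show "0 \<le> w i s x" for x using W by (simp add: w_def W_def)
    qed (use wx in auto)
    have "p \<in> sphere 0 1" "{x. w i s x \<noteq> 0} \<union> {x. sphere_map p x \<noteq> 0} \<in> N"
      using W by (simp_all only: W_def w_def)
    moreover have "\<forall>x. w i s x \<noteq> 0 \<longrightarrow> F t x \<noteq> 0" using v wx by blast
    ultimately show ?thesis
      using wN unfolding t_def[symmetric] hps fz fst_conv snd_conv by blast
  qed
  have cont: "continuous_on (sphere 0 1) (\<lambda>z. h (?t z))"
    by (rule continuous_on_circle_Arg2pi[OF conth h01])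
  show thesis
  proof (rule extends_if_contiguous_to_sphere_map[of f "\<lambda>z. snd (h (?t z))" "\<lambda>z. fst (h (?t z))"])
    fix g assume "continuous_on (cball 0 1) g" "\<And>x. x \<in> cball 0 1 \<Longrightarrow> g x \<in> realization_set N"
      "\<And>x. x \<in> sphere 0 1 \<Longrightarrow> g x = f x"
    then show thesis by (rule that)
  qed (use f hz cont in \<open>auto intro: continuous_on_fst continuous_on_snd\<close>)
qed

lemma k_connected_1: "k_connected 1 (geometric_realization N)"
  unfolding k_connected_def geometric_realization_top_of_set
proof (intro conjI allI impI)
  show "topspace (top_of_set (realization_set N)) \<noteq> {}"
    using sphere_map_realization[of "axis 1 1"] by (auto simp: norm_axis_1)
  fix l :: nat and f
  assume "l \<le> 1" and f: "continuous_map (nsphere l) (top_of_set (realization_set N)) f"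
  then consider "l = 0" | "l = 1" by linarith
  then show "\<exists>g. continuous_map (nball (Suc l)) (top_of_set (realization_set N)) g \<and>
      (\<forall>x\<in>topspace (nsphere l). g x = f x)"
  proof cases
    case 1
    have dim: "DIM(real) = Suc 0" by simp
    have "\<forall>f :: real \<Rightarrow> real^3 \<Rightarrow> real. continuous_on (sphere 0 1) f \<and> f \<in> sphere 0 1 \<rightarrow> realization_set N \<longrightarrow>
        (\<exists>g. continuous_on (cball 0 1) g \<and> g \<in> cball 0 1 \<rightarrow> realization_set N \<and> (\<forall>x\<in>sphere 0 1. g x = f x))"
    proof (intro allI impI)
      fix f :: "real \<Rightarrow> real^3 \<Rightarrow> real"
      assume f: "continuous_on (sphere 0 1) f \<and> f \<in> sphere 0 1 \<rightarrow> realization_set N"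
      show "\<exists>g. continuous_on (cball 0 1) g \<and> g \<in> cball 0 1 \<rightarrow> realization_set N \<and> (\<forall>x\<in>sphere 0 1. g x = f x)"
        by (rule extends_from_0_sphere[of f]) (use f in blast)+
    qed
    from extension_property_nsphere_iff[where 'm=real, OF dim, THEN iffD2, OF this] f 1
    show ?thesis by blast
  next
    case 2
    have dim: "DIM(complex) = Suc 1" by simp
    have "\<forall>f :: complex \<Rightarrow> real^3 \<Rightarrow> real. continuous_on (sphere 0 1) f \<and> f \<in> sphere 0 1 \<rightarrow> realization_set N \<longrightarrow>
        (\<exists>g. continuous_on (cball 0 1) g \<and> g \<in> cball 0 1 \<rightarrow> realization_set N \<and> (\<forall>x\<in>sphere 0 1. g x = f x))"
    proof (intro allI impI)
      fix f :: "complex \<Rightarrow> real^3 \<Rightarrow> real"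
      assume f: "continuous_on (sphere 0 1) f \<and> f \<in> sphere 0 1 \<rightarrow> realization_set N"
      show "\<exists>g. continuous_on (cball 0 1) g \<and> g \<in> cball 0 1 \<rightarrow> realization_set N \<and> (\<forall>x\<in>sphere 0 1. g x = f x)"
        by (rule extends_from_1_sphere[of f]) (use f in blast)+
    qed
    from extension_property_nsphere_iff[where 'm=complex, OF dim, THEN iffD2, OF this] f 2
    show ?thesis by blast
  qed
qed

lemma conn_ge_1: "conn (geometric_realization N) \<ge> 1"
proof -
  have "topspace (geometric_realization N) \<noteq> {}" using k_connected_1 by (auto simp: k_connected_def)
  then have "conn (geometric_realization N) =
      Sup (insert (- 1) {ereal (real k) | k. k_connected k (geometric_realization N)})"
    by (simp only: conn_def if_False)
  moreover have "ereal (real 1) \<in> insert (- 1) {ereal (real k) | k. k_connected k (geometric_realization N)}"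
    using k_connected_1 by blast
  ultimately show ?thesis
    using Sup_upper[of "ereal (real 1)"] by (simp only: of_nat_1 one_ereal_def)
qed

lemma conn_eq_1:
  assumes "\<epsilon> < \<bar>\<alpha> - pi / 2\<bar>"
  shows "conn (geometric_realization N) = 1"
proof (rule antisym[OF _ conn_ge_1])
  have "k \<le> 1" if "k_connected k (geometric_realization N)" for k
  proof (rule ccontr)
    assume "\<not> k \<le> 1"
    \<comment> \<open>\<open>k_connected\<close> quantifies over all \<open>l \<le> k\<close>, so it
      passes to smaller \<open>k\<close>.\<close>
    then have "k_connected 2 (geometric_realization N)"
      using that by (auto simp: k_connected_def)
    then show False using not_2_connected[OF assms] by blast
  qed
  moreover have "topspace (geometric_realization N) \<noteq> {}" using k_connected_1 by (auto simp: k_connected_def)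
  ultimately show "conn (geometric_realization N) \<le> 1"
    unfolding conn_def by (auto intro!: Sup_least simp: one_ereal_def)
qed

end

section \<open>From nets to random points\<close>

text \<open>Supplies \<open>0 < \<epsilon> n\<close> on the net event: with
  \<open>\<delta> \<le> 0\<close>, a \<open>\<delta>\<close>-net would contain the whole sphere,
  which is infinite.\<close>

lemma is_net_finite_pos:
  assumes "is_net \<delta> X" "finite X"
  shows "\<delta> > 0"
proof (rule ccontr)
  assume \<delta>: "\<not> \<delta> > 0"
  have "sphere 0 1 \<subseteq> X"
  proof
    fix y :: "real^3" assume y: "y \<in> sphere 0 1"
    then obtain x where x: "x \<in> X" "x \<in> sphere 0 1" "geodesic_dist x y \<le> \<delta>"
      using assms(1) unfolding is_net_def by blast
    then have "geodesic_dist x y = 0" using geodesic_dist_nonneg[OF x(2) y] \<delta> by linarith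
    then have "x \<bullet> y = 1" using cos_geodesic_dist[OF x(2) y] by simp
    then have "(norm (x - y))\<^sup>2 = 0"
      using dot_norm_neg[of x y] x(2) y by simp
    then show "y \<in> X" using x(1) by simp
  qed
  then have "finite (sphere 0 1 :: (real^3) set)" using assms(2) by (rule finite_subset)
  \<comment> \<open>A finite connected set has at most one point, whereas the sphere contains the
    antipodal pair \<open>e\<close>, \<open>- e\<close>.\<close>
  moreover have "connected (sphere 0 1 :: (real^3) set)" by (intro connected_sphere) simp
  ultimately have "sphere 0 1 = ({} :: (real^3) set) \<or> (\<exists>a :: real^3. sphere 0 1 = {a})"
    by (simp only: connected_finite_iff_sing)
  then obtain a :: "real^3" where a: "sphere 0 1 \<subseteq> {a}" by (elim disjE exE) simp_all
  define e :: "real^3" where "e = axis 1 1"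
  have "e \<in> {a}" "- e \<in> {a}" by (rule subsetD[OF a], simp add: e_def norm_axis_1)+
  then have "e = a" "- e = a" by (simp_all only: singleton_iff)
  then have "e = - e" by (rule trans[OF _ sym])
  then have "e \<bullet> e = - (e \<bullet> e)" by (metis inner_minus_left)
  moreover have "e \<bullet> e = 1" by (simp add: e_def flip: norm_eq_1)
  ultimately show False by simp
qed

text \<open>The probability of \<open>E n\<close> is squeezed between that of the net event and 1;
  monotonicity of the measure rests on the measurability of \<open>E n\<close>.\<close>

lemma aas_if_eventually_net:
  assumes net: "aas (\<lambda>n X. is_net (\<epsilon> n / 4) (X ` {1..n}))"
    and sets: "\<And>n. {X \<in> space (iid_sphere n). E n X} \<in> sets (iid_sphere n)"
    and E: "\<forall>\<^sub>F n in sequentially. \<forall>X. is_net (\<epsilon> n / 4) (X ` {1..n}) \<longrightarrow> E n X"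
  shows "aas E"
proof -
  have prob: "prob_space (iid_sphere n)" for n
    unfolding iid_sphere_def by (intro prob_space_PiM prob_space_uniform_sphere)
  have "\<forall>\<^sub>F n in sequentially. \<P>(X in iid_sphere n. is_net (\<epsilon> n / 4) (X ` {1..n})) \<le> \<P>(X in iid_sphere n. E n X)"
    using E
  proof eventually_elim
    case (elim n)
    interpret prob_space "iid_sphere n" by (rule prob)
    show ?case using elim sets by (intro finite_measure_mono) auto
  qed
  moreover have "\<P>(X in iid_sphere n. E n X) \<le> 1" for n
    using prob_space.prob_le_1[OF prob] by blast
  ultimately show ?thesis
    using net unfolding aas_def by (auto intro: tendsto_sandwich[where h="\<lambda>_. 1"])
qed

theorem theorem5p1:
  fixes \<alpha> C\<^sub>2 :: real and \<epsilon> :: "nat \<Rightarrow> real"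
  assumes "net_constant C\<^sub>2"
    and "0 < \<alpha>" and "\<alpha> \<le> pi"
    and "admissible_radius C\<^sub>2 \<epsilon>"
  shows "aas (\<lambda>n X. conn (geometric_realization
             (neighborhood_complex (distance_graph \<alpha> (\<epsilon> n) (X ` {1..n})))) \<ge> 1) \<and>
         (\<alpha> \<noteq> pi / 2 \<longrightarrow>
          aas (\<lambda>n X. conn (geometric_realization
             (neighborhood_complex (distance_graph \<alpha> (\<epsilon> n) (X ` {1..n})))) = 1))"
proof (intro conjI impI)
  let ?conn = "\<lambda>n X. conn (geometric_realization (neighborhood_complex (distance_graph \<alpha> (\<epsilon> n) (X ` {1..n}))))"
  have net: "aas (\<lambda>n X. is_net (\<epsilon> n / 4) (X ` {1..n}))"
    using assms by (simp add: net_constant_def)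
  have \<epsilon>0: "\<epsilon> \<longlonglongrightarrow> 0" using assms(4) by (simp add: admissible_radius_def)
  \<comment> \<open>Both events are conditions on the value \<open>?conn n X\<close>, so one
    statement for arbitrary \<open>Q\<close> covers them.\<close>
  have sets: "{X \<in> space (iid_sphere n). Q (?conn n X)} \<in> sets (iid_sphere n)" for Q n
  proof (rule sets_iid_sphere_pattern[of \<alpha> "\<epsilon> n"])
    fix X Y assume "adjacency_pattern \<alpha> (\<epsilon> n) {1..n} X = adjacency_pattern \<alpha> (\<epsilon> n) {1..n} Y"
    from conn_neighborhood_complex_pattern_cong[OF this]
    show "Q (?conn n X) = Q (?conn n Y)" by (rule arg_cong)
  qed
  have graph: "sphere_net_graph (X ` {1..n}) \<alpha> (\<epsilon> n)" if "\<epsilon> n < \<alpha>" "is_net (\<epsilon> n / 4) (X ` {1..n})" for n X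
    using that is_net_finite_pos[OF that(2)] assms(3) by unfold_locales auto
  have small: "\<forall>\<^sub>F n in sequentially. \<epsilon> n < \<alpha>"
    using order_tendstoD(2)[OF \<epsilon>0] assms(2) by simp
  show "aas (\<lambda>n X. ?conn n X \<ge> 1)"
  proof (rule aas_if_eventually_net[OF net])
    show "\<forall>\<^sub>F n in sequentially. \<forall>X. is_net (\<epsilon> n / 4) (X ` {1..n}) \<longrightarrow> ?conn n X \<ge> 1"
      using small by eventually_elim (blast intro: sphere_net_graph.conn_ge_1 graph)
  qed (rule sets)
  assume "\<alpha> \<noteq> pi / 2"
  \<comment> \<open>The gap between \<open>\<alpha>\<close> and \<open>pi / 2\<close> is positive
    and fixed, while \<open>\<epsilon>\<close> tends to 0.\<close>
  then have "\<forall>\<^sub>F n in sequentially. \<epsilon> n < \<bar>\<alpha> - pi / 2\<bar>"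
    using order_tendstoD(2)[OF \<epsilon>0] by simp
  with small have *: "\<forall>\<^sub>F n in sequentially. \<forall>X. is_net (\<epsilon> n / 4) (X ` {1..n}) \<longrightarrow> ?conn n X = 1"
    by eventually_elim (blast intro: sphere_net_graph.conn_eq_1 graph)
  show "aas (\<lambda>n X. ?conn n X = 1)"
    by (rule aas_if_eventually_net[OF net sets *])
qed

end
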